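(* The state space functor $\mathrm{Stat}\colon(\mathbf{Cstar}_{\mathrm{PU}})^{\mathrm{op}}\to\mathbf{CCLcvx}$ is full and faithful.
   Context: All $C^*$-algebras are unital over $\mathbb{C}$, not necessarily commutative (the zero algebra is allowed). An element is positive if it is of the form $y^*y$; a PU-map (positive unital map) is a linear map preserving positive elements and the unit. $\mathbf{Cstar}_{\mathrm{PU}}$ is the category of all $C^*$-algebras with PU-maps. $\mathbf{CCLcvx}$ is the category whose objects are pairs $(V,X)$ with $V$ a Hausdorff locally convex topological vector space and $X\subseteq V$ a compact convex subset; morphisms $(V,X)\to(W,Y)$ are continuous affine maps $X\to Y$ (affine means preserving finite convex combinations). For a $C^*$-algebra $A$, $\mathrm{Stat}(A)$ is the set of PU-maps $A\to\mathbb{C}$, a compact convex subset of the dual space of $A$ with the weak-* topology. For a PU-map $f\colon A\to B$, $\mathrm{Stat}(f)\colon\mathrm{Stat}(B)\to\mathrm{Stat}(A)$ is $\phi\mapsto\phi\circ f$. *)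

theory Defs
  imports "HOL-Analysis.Analysis"
begin

section \<open>Unital C*-algebras and positive unital maps\<close>

text \<open>
  The real normed structure of the library is the restriction of the complex one.
  Commutativity is not assumed, and neither is \<open>0 \<noteq> 1\<close> (which is part of the library class
  \<^class>\<open>ring_1\<close>), so that the zero algebra is included.
\<close>

class cstar_algebra = real_normed_algebra + banach + monoid_mult +
  fixes scaleC :: "complex \<Rightarrow> 'a \<Rightarrow> 'a" (infixr "*\<^sub>C" 75)
    and star :: "'a \<Rightarrow> 'a"
  assumes scaleC_complex_of_real: "complex_of_real r *\<^sub>C x = r *\<^sub>R x"
    and scaleC_add_right: "c *\<^sub>C (x + y) = c *\<^sub>C x + c *\<^sub>C y"
    and scaleC_add_left: "(c + d) *\<^sub>C x = c *\<^sub>C x + d *\<^sub>C x"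
    and scaleC_scaleC: "c *\<^sub>C (d *\<^sub>C x) = (c * d) *\<^sub>C x"
    and mult_scaleC_left: "(c *\<^sub>C x) * y = c *\<^sub>C (x * y)"
    and mult_scaleC_right: "x * (c *\<^sub>C y) = c *\<^sub>C (x * y)"
    and norm_scaleC: "norm (c *\<^sub>C x) = cmod c * norm x"
    and star_star: "star (star x) = x"
    and star_add: "star (x + y) = star x + star y"
    and star_scaleC: "star (c *\<^sub>C x) = cnj c *\<^sub>C star x"
    and star_mult: "star (x * y) = star y * star x"
    and cstar_identity: "norm (star x * x) = (norm x)\<^sup>2"

instantiation complex :: cstar_algebra
begin

definition scaleC_complex :: "complex \<Rightarrow> complex \<Rightarrow> complex" where
  "scaleC_complex c x = c * x"

definition star_complex :: "complex \<Rightarrow> complex" where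
  "star_complex x = cnj x"

instance
  by standard
    (simp_all add: scaleC_complex_def star_complex_def algebra_simps scaleR_conv_of_real
      norm_mult power2_eq_square)

end

definition cstar_positive :: "'a::cstar_algebra \<Rightarrow> bool" where
  "cstar_positive x \<longleftrightarrow> (\<exists>y. x = star y * y)"

definition clinear_map :: "('a::cstar_algebra \<Rightarrow> 'b::cstar_algebra) \<Rightarrow> bool" where
  "clinear_map f \<longleftrightarrow> (\<forall>x y. f (x + y) = f x + f y) \<and> (\<forall>c x. f (c *\<^sub>C x) = c *\<^sub>C f x)"

definition pu_map :: "('a::cstar_algebra \<Rightarrow> 'b::cstar_algebra) \<Rightarrow> bool" where
  "pu_map f \<longleftrightarrow> clinear_map f \<and> (\<forall>x. cstar_positive x \<longrightarrow> cstar_positive (f x)) \<and> f 1 = 1"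

lemma pu_map_id: "pu_map id"
  by (simp add: pu_map_def clinear_map_def)

lemma pu_map_comp: "pu_map g \<Longrightarrow> pu_map f \<Longrightarrow> pu_map (g \<circ> f)"
  by (simp add: pu_map_def clinear_map_def)


section \<open>Compact convex subsets of Hausdorff locally convex spaces\<close>

class hausdorff_lctvs = real_vector + topological_ab_group_add + t2_space +
  assumes tendsto_scaleR_nhds:
      "LIM p (nhds r \<times>\<^sub>F nhds x). fst p *\<^sub>R snd p :> nhds (r *\<^sub>R x)"
    and locally_convex_raw:
      "open U \<Longrightarrow> x \<in> U \<Longrightarrow> \<exists>C. open C \<and>
        (\<forall>y\<in>C. \<forall>z\<in>C. \<forall>u\<ge>0. \<forall>v\<ge>0. u + v = 1 \<longrightarrow> u *\<^sub>R y + v *\<^sub>R z \<in> C) \<and>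
        x \<in> C \<and> C \<subseteq> U"

lemma locally_convex:
  fixes x :: "'v::hausdorff_lctvs"
  shows "open U \<Longrightarrow> x \<in> U \<Longrightarrow> \<exists>C. open C \<and> convex C \<and> x \<in> C \<and> C \<subseteq> U"
  unfolding convex_def by (rule locally_convex_raw)

text \<open>
  An object \<open>(V, X)\<close> is a type \<open>V\<close> of class \<open>hausdorff_lctvs\<close> together with a set \<open>X\<close>
  satisfying the following predicate. Morphisms are functions on \<open>X\<close> only, hence are
  represented as extensional functions.
\<close>

definition cclcvx_obj :: "'v::hausdorff_lctvs set \<Rightarrow> bool" where
  "cclcvx_obj X \<longleftrightarrow> compact X \<and> convex X"

definition affine_map_on :: "'v::real_vector set \<Rightarrow> ('v \<Rightarrow> 'w::real_vector) \<Rightarrow> bool" where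
  "affine_map_on X h \<longleftrightarrow>
    (\<forall>(n::nat) u x. (\<forall>i<n. 0 \<le> u i \<and> x i \<in> X) \<longrightarrow> (\<Sum>i<n. u i) = 1 \<longrightarrow>
       h (\<Sum>i<n. u i *\<^sub>R x i) = (\<Sum>i<n. u i *\<^sub>R h (x i)))"

definition cclcvx_hom ::
  "'v::hausdorff_lctvs set \<Rightarrow> 'w::hausdorff_lctvs set \<Rightarrow> ('v \<Rightarrow> 'w) set" where
  "cclcvx_hom X Y = {h \<in> X \<rightarrow>\<^sub>E Y. continuous_on X h \<and> affine_map_on X h}"

lemma restrict_id_cclcvx_hom:
  assumes "cclcvx_obj X" shows "restrict id X \<in> cclcvx_hom X X"
proof -
  have "affine_map_on X (restrict id X)"
    unfolding affine_map_on_def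
  proof (intro allI impI)
    fix n :: nat and u :: "nat \<Rightarrow> real" and x
    assume *: "\<forall>i<n. 0 \<le> u i \<and> x i \<in> X" "(\<Sum>i<n. u i) = 1"
    have "(\<Sum>i<n. u i *\<^sub>R x i) \<in> X"
      using assms * by (intro convex_sum) (auto simp: cclcvx_obj_def)
    then show "restrict id X (\<Sum>i<n. u i *\<^sub>R x i) = (\<Sum>i<n. u i *\<^sub>R restrict id X (x i))"
      using * by (auto intro!: sum.cong)
  qed
  moreover have "continuous_on X (restrict id X)"
    by (subst continuous_on_cong[OF refl, where g = id]) (auto intro: continuous_on_id)
  ultimately show ?thesis by (auto simp: cclcvx_hom_def)
qed

lemma compose_cclcvx_hom:
  assumes X: "cclcvx_obj X" and h: "h \<in> cclcvx_hom X Y" and k: "k \<in> cclcvx_hom Y Z"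
  shows "compose X k h \<in> cclcvx_hom X Z"
proof -
  have hX: "h x \<in> Y" if "x \<in> X" for x using h that by (auto simp: cclcvx_hom_def)
  have "affine_map_on X (compose X k h)"
    unfolding affine_map_on_def
  proof (intro allI impI)
    fix n :: nat and u :: "nat \<Rightarrow> real" and x
    assume *: "\<forall>i<n. 0 \<le> u i \<and> x i \<in> X" "(\<Sum>i<n. u i) = 1"
    have "(\<Sum>i<n. u i *\<^sub>R x i) \<in> X"
      using X * by (intro convex_sum) (auto simp: cclcvx_obj_def)
    then have "compose X k h (\<Sum>i<n. u i *\<^sub>R x i) = k (\<Sum>i<n. u i *\<^sub>R h (x i))"
      using h * by (simp add: compose_def cclcvx_hom_def affine_map_on_def)
    also have "\<dots> = (\<Sum>i<n. u i *\<^sub>R k (h (x i)))"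
      using k * hX by (simp add: cclcvx_hom_def affine_map_on_def)
    finally show "compose X k h (\<Sum>i<n. u i *\<^sub>R x i) = (\<Sum>i<n. u i *\<^sub>R compose X k h (x i))"
      using * by (auto intro!: sum.cong simp: compose_def)
  qed
  moreover have "continuous_on X (compose X k h)"
  proof -
    have "continuous_on X (\<lambda>x. k (h x))"
      by (rule continuous_on_compose2[of Y k]) (use h k hX in \<open>auto simp: cclcvx_hom_def\<close>)
    then show ?thesis by (simp add: compose_def cong: continuous_on_cong)
  qed
  ultimately show ?thesis
    using h k by (auto simp: cclcvx_hom_def PiE_iff compose_def)
qed


section \<open>The dual space with the weak-* topology\<close>

typedef (overloaded) 'a wdual =
  "{\<phi> :: 'a::cstar_algebra \<Rightarrow> complex. clinear_map \<phi> \<and> (\<exists>K. \<forall>x. cmod (\<phi> x) \<le> K * norm x)}"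
  morphisms wd_apply Abs_wdual
  by (rule exI[of _ "\<lambda>_. 0"])
    (auto simp: clinear_map_def scaleC_complex_def intro: exI[of _ 0])

lemma wd_add: "wd_apply \<phi> (x + y) = wd_apply \<phi> x + wd_apply \<phi> y"
  and wd_scaleC: "wd_apply \<phi> (c *\<^sub>C x) = c * wd_apply \<phi> x"
  using wd_apply[of \<phi>] by (auto simp: clinear_map_def scaleC_complex_def)

lemma wd_bounded: "\<exists>K. \<forall>x. cmod (wd_apply \<phi> x) \<le> K * norm x"
  using wd_apply[of \<phi>] by auto

lemma wd_eqI: "(\<And>x. wd_apply \<phi> x = wd_apply \<psi> x) \<Longrightarrow> \<phi> = \<psi>"
  by (metis ext wd_apply_inject)

instantiation wdual :: (cstar_algebra) real_vector
begin

definition "0 = Abs_wdual (\<lambda>_. 0)"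
definition "\<phi> + \<psi> = Abs_wdual (\<lambda>x. wd_apply \<phi> x + wd_apply \<psi> x)"
definition "- \<phi> = Abs_wdual (\<lambda>x. - wd_apply \<phi> x)"
definition "(\<phi> :: 'a wdual) - \<psi> = \<phi> + (- \<psi>)"
definition "r *\<^sub>R \<phi> = Abs_wdual (\<lambda>x. r *\<^sub>R wd_apply \<phi> x)"

lemma wd_zero [simp]: "wd_apply 0 x = 0"
  unfolding zero_wdual_def
  by (subst Abs_wdual_inverse) (auto simp: clinear_map_def scaleC_complex_def intro: exI[of _ 0])

lemma wd_plus [simp]: "wd_apply (\<phi> + \<psi>) x = wd_apply \<phi> x + wd_apply \<psi> x"
proof -
  obtain K L where "\<forall>x. cmod (wd_apply \<phi> x) \<le> K * norm x" "\<forall>x. cmod (wd_apply \<psi> x) \<le> L * norm x"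
    using wd_bounded by metis
  then have "\<forall>x. cmod (wd_apply \<phi> x + wd_apply \<psi> x) \<le> (K + L) * norm x"
    by (metis (no_types) add_mono distrib_right norm_triangle_ineq order_trans)
  then show ?thesis
    unfolding plus_wdual_def
    by (subst Abs_wdual_inverse)
      (auto simp: clinear_map_def scaleC_complex_def wd_add wd_scaleC distrib_left)
qed

lemma wd_scaleR [simp]: "wd_apply (r *\<^sub>R \<phi>) x = r *\<^sub>R wd_apply \<phi> x"
proof -
  obtain K where K: "\<forall>x. cmod (wd_apply \<phi> x) \<le> K * norm x" using wd_bounded by metis
  have "\<forall>x. cmod (r *\<^sub>R wd_apply \<phi> x) \<le> (\<bar>r\<bar> * K) * norm x"
    using K by (simp add: mult_left_mono mult.assoc)
  then show ?thesis
    unfolding scaleR_wdual_def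
    by (subst Abs_wdual_inverse)
      (auto simp: clinear_map_def scaleC_complex_def wd_add wd_scaleC scaleR_right_distrib
        simp del: norm_scaleR)
qed

lemma wd_uminus [simp]: "wd_apply (- \<phi>) x = - wd_apply \<phi> x"
  unfolding uminus_wdual_def
  using wd_bounded[of \<phi>]
  by (subst Abs_wdual_inverse)
    (auto simp: clinear_map_def scaleC_complex_def wd_add wd_scaleC algebra_simps)

lemma wd_minus [simp]: "wd_apply (\<phi> - \<psi>) x = wd_apply \<phi> x - wd_apply \<psi> x"
  by (simp add: minus_wdual_def)

instance
  by standard (rule wd_eqI; simp add: algebra_simps)+

end

instantiation wdual :: (cstar_algebra) topological_space
begin

text \<open>The weak-* topology: the coarsest one making all evaluations continuous.\<close>

definition open_wdual :: "'a wdual set \<Rightarrow> bool" where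
  "open_wdual = generate_topology {(\<lambda>\<phi>. wd_apply \<phi> x) -` T | x T. open T}"

instance
  by (intro_classes; unfold open_wdual_def)
    (auto intro: generate_topology.UNIV generate_topology.Int generate_topology.UN)

end

lemma open_wdual_basis: "open T \<Longrightarrow> open {\<phi>. wd_apply \<phi> x \<in> T}"
  unfolding open_wdual_def by (rule generate_topology.Basis) (auto simp: vimage_def)

lemma tendsto_wdual_iff:
  "filterlim f (nhds \<phi>) F \<longleftrightarrow> (\<forall>x. ((\<lambda>z. wd_apply (f z) x) \<longlongrightarrow> wd_apply \<phi> x) F)"
proof
  assume L: "filterlim f (nhds \<phi>) F"
  show "\<forall>x. ((\<lambda>z. wd_apply (f z) x) \<longlongrightarrow> wd_apply \<phi> x) F"
  proof (intro allI topological_tendstoI)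
    fix x T assume "open T" "wd_apply \<phi> x \<in> T"
    then show "\<forall>\<^sub>F z in F. wd_apply (f z) x \<in> T"
      using topological_tendstoD[OF L open_wdual_basis[of T x]] by simp
  qed
next
  assume R: "\<forall>x. ((\<lambda>z. wd_apply (f z) x) \<longlongrightarrow> wd_apply \<phi> x) F"
  show "filterlim f (nhds \<phi>) F"
  proof (rule topological_tendstoI)
    fix S assume "open S" "\<phi> \<in> S"
    then show "\<forall>\<^sub>F z in F. f z \<in> S"
      unfolding open_wdual_def
    proof (induction rule: generate_topology.induct)
      case (UN K)
      then obtain k where k: "k \<in> K" "\<phi> \<in> k" by blast
      with UN have "\<forall>\<^sub>F z in F. f z \<in> k" by blast
      then show ?case by (rule eventually_mono) (use k in blast)
    next
      case (Basis s)
      then obtain x T where s: "s = (\<lambda>\<phi>. wd_apply \<phi> x) -` T" "open T" by blast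
      with Basis R show ?case
        using topological_tendstoD[of "\<lambda>z. wd_apply (f z) x" "wd_apply \<phi> x" F T] by simp
    qed (auto elim: eventually_elim2)
  qed
qed

lemma tendsto_wd_apply: "((\<lambda>\<phi>. wd_apply \<phi> x) \<longlongrightarrow> wd_apply \<phi> x) (nhds \<phi>)"
  using tendsto_wdual_iff[of "\<lambda>\<phi>. \<phi>" \<phi> "nhds \<phi>"] by (simp add: filterlim_ident)

instance wdual :: (cstar_algebra) hausdorff_lctvs
proof
  fix \<phi> \<psi> :: "'a wdual" and r :: real
  have fst: "((\<lambda>p. wd_apply (fst p) x) \<longlongrightarrow> wd_apply \<phi> x) (nhds \<phi> \<times>\<^sub>F nhds \<psi>)" for x
    using filterlim_compose[OF tendsto_wd_apply filterlim_fst] .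
  have snd: "((\<lambda>p. wd_apply (snd p) x) \<longlongrightarrow> wd_apply \<psi> x) (F \<times>\<^sub>F nhds \<psi>)"
    for x and F :: "'b filter"
    using filterlim_compose[OF tendsto_wd_apply filterlim_snd] .
  show "LIM p (nhds \<phi> \<times>\<^sub>F nhds \<psi>). fst p + snd p :> nhds (\<phi> + \<psi>)"
    unfolding tendsto_wdual_iff wd_plus by (intro allI tendsto_add fst snd)
  show "filterlim uminus (nhds (- \<phi>)) (nhds \<phi>)"
    unfolding tendsto_wdual_iff wd_uminus by (intro allI tendsto_minus tendsto_wd_apply)
  have "(fst \<longlongrightarrow> r) (nhds r \<times>\<^sub>F nhds \<psi>)" by (rule filterlim_fst)
  then show "LIM p (nhds r \<times>\<^sub>F nhds \<psi>). fst p *\<^sub>R snd p :> nhds (r *\<^sub>R \<psi>)"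
    unfolding tendsto_wdual_iff wd_scaleR by (intro allI tendsto_scaleR snd)
next
  fix \<phi> \<psi> :: "'a wdual" assume "\<phi> \<noteq> \<psi>"
  then obtain x where "wd_apply \<phi> x \<noteq> wd_apply \<psi> x" using wd_eqI by blast
  then obtain S T where "open S" "open T" "wd_apply \<phi> x \<in> S" "wd_apply \<psi> x \<in> T" "S \<inter> T = {}"
    using hausdorff by metis
  then show "\<exists>U V. open U \<and> open V \<and> \<phi> \<in> U \<and> \<psi> \<in> V \<and> U \<inter> V = {}"
    by (intro exI[of _ "{\<phi>. wd_apply \<phi> x \<in> S}"] exI[of _ "{\<phi>. wd_apply \<phi> x \<in> T}"])
      (auto intro: open_wdual_basis)
next
  fix U :: "'a wdual set" and \<phi> assume "open U" "\<phi> \<in> U"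
  then show "\<exists>C. open C \<and>
      (\<forall>y\<in>C. \<forall>z\<in>C. \<forall>u\<ge>0. \<forall>v\<ge>0. u + v = 1 \<longrightarrow> u *\<^sub>R y + v *\<^sub>R z \<in> C) \<and>
      \<phi> \<in> C \<and> C \<subseteq> U"
    unfolding convex_def[symmetric] open_wdual_def[where 'a = 'a]
  proof (induction rule: generate_topology.induct)
    case UNIV
    then show ?case by (intro exI[of _ UNIV]) (auto intro: generate_topology.UNIV)
  next
    case (Int a b)
    then obtain C D where "generate_topology {(\<lambda>\<phi>. wd_apply \<phi> x) -` T | x T. open T} C"
      "convex C" "\<phi> \<in> C" "C \<subseteq> a"
      "generate_topology {(\<lambda>\<phi>. wd_apply \<phi> x) -` T | x T. open T} D" "convex D" "\<phi> \<in> D" "D \<subseteq> b"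
      by blast
    then show ?case
      by (intro exI[of _ "C \<inter> D"]) (auto intro: generate_topology.Int convex_Int)
  next
    case (UN K)
    then show ?case by (meson Union_iff Union_upper order_trans)
  next
    case (Basis s)
    then obtain x T where s: "s = (\<lambda>\<phi>. wd_apply \<phi> x) -` T" "open T" by blast
    with Basis obtain e where e: "e > 0" "ball (wd_apply \<phi> x) e \<subseteq> T"
      using open_contains_ball by (metis vimageE)
    have "convex ((\<lambda>\<phi>. wd_apply \<phi> x) -` ball (wd_apply \<phi> x) e)"
      by (intro convex_linear_vimage convex_ball) (auto intro!: linearI)
    then show ?case using e s
      by (intro exI[of _ "(\<lambda>\<phi>. wd_apply \<phi> x) -` ball (wd_apply \<phi> x) e"])
        (auto intro!: generate_topology.Basis)
  qed
qed


section \<open>The state space functor\<close>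

definition stat :: "'a::cstar_algebra wdual set" where
  "stat = {\<phi>. pu_map (wd_apply \<phi>)}"

definition stat_map ::
  "('a::cstar_algebra \<Rightarrow> 'b::cstar_algebra) \<Rightarrow> 'b wdual \<Rightarrow> 'a wdual" where
  "stat_map f = (\<lambda>\<phi>\<in>stat. Abs_wdual (wd_apply \<phi> \<circ> f))"

text \<open>
  Every positive unital map into the complex numbers is automatically bounded. Hence
  \<^const>\<open>stat\<close> consists of all of them, and \<^const>\<open>Abs_wdual\<close> is only
  applied to bounded functionals in the definition of \<^const>\<open>stat_map\<close>.
\<close>

lemma star_zero [simp]: "star (0 :: 'a::cstar_algebra) = 0"
  using star_add[of "0::'a" 0] by simp

lemma star_one [simp]: "star (1 :: 'a::cstar_algebra) = 1"
  by (metis mult.right_neutral star_mult star_star)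

lemma star_scaleR: "star (r *\<^sub>R x) = r *\<^sub>R star (x :: 'a::cstar_algebra)"
  by (metis complex_cnj_complex_of_real scaleC_complex_of_real star_scaleC)

lemma norm_star: "norm (star x) = norm (x :: 'a::cstar_algebra)"
proof -
  have le: "norm y \<le> norm (star y)" for y :: 'a
  proof (cases "y = 0")
    case False
    have "norm y * norm y \<le> norm (star y) * norm y"
      using norm_mult_ineq[of "star y" y] by (simp add: cstar_identity power2_eq_square)
    then show ?thesis using False by simp
  qed simp
  show ?thesis using le[of x] le[of "star x"] by (simp add: star_star)
qed

lemma bounded_linear_star: "bounded_linear (star :: 'a::cstar_algebra \<Rightarrow> 'a)"
  by (rule bounded_linear_intro[where K = 1]) (simp_all add: star_add star_scaleR norm_star)

lemma star_power: "star (x ^ n) = star x ^ n" for x :: "'a::cstar_algebra"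
  by (induction n) (simp_all add: star_mult power_commutes)

lemma norm_power_le: "norm (x ^ n) \<le> norm (1 :: 'a) * norm x ^ n" for x :: "'a::cstar_algebra"
proof (induction n)
  case (Suc n)
  have "norm (x ^ Suc n) \<le> norm x * norm (x ^ n)" by (simp add: norm_mult_ineq)
  also have "\<dots> \<le> norm x * (norm (1::'a) * norm x ^ n)"
    by (intro mult_left_mono Suc) simp
  finally show ?case by (simp add: ac_simps)
qed simp

lemma abs_gbinomial_half_le: "\<bar>(1/2 :: real) gchoose n\<bar> \<le> 1"
proof (induction n)
  case (Suc n)
  have "(1/2 :: real) gchoose Suc n = ((1/2) gchoose n) * ((1/2 - real n) / (real n + 1))"
    using gbinomial_mult_1[of "1/2::real" n] by (simp add: field_simps)
  moreover have "\<bar>(1/2 - real n) / (real n + 1)\<bar> \<le> 1" by (simp add: abs_if divide_simps)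
  ultimately show ?case
    using Suc by (metis abs_mult abs_ge_zero mult_le_one)
qed simp

lemma positive_one_plus:
  fixes x :: "'a::cstar_algebra"
  assumes sa: "star x = x" and n: "norm x < 1"
  shows "cstar_positive (1 + x)"
proof -
  define c where "c = (\<lambda>n. (1/2 :: real) gchoose n)"
  define a where "a = (\<lambda>n. c n *\<^sub>R x ^ n)"
  have le: "norm (a k) \<le> norm (1::'a) * norm x ^ k" for k
  proof -
    have "norm (a k) = \<bar>c k\<bar> * norm (x ^ k)" by (simp add: a_def)
    also have "\<dots> \<le> 1 * (norm (1::'a) * norm x ^ k)"
      using abs_gbinomial_half_le[of k] by (intro mult_mono norm_power_le) (auto simp: c_def)
    finally show ?thesis by simp
  qed
  have "summable (\<lambda>k. norm (1::'a) * norm x ^ k)"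
    using n by (intro summable_mult summable_geometric) simp
  then have sn: "summable (\<lambda>k. norm (a k))"
    by (rule summable_comparison_test'[where N = 0]) (simp only: real_norm_def abs_norm_cancel le)
  then have s: "summable a" by (rule summable_norm_cancel)
  define y where "y = (\<Sum>k. a k)"
  have "star y = (\<Sum>k. star (a k))"
    unfolding y_def by (rule bounded_linear.suminf[OF bounded_linear_star s])
  then have y: "star y = y" by (simp add: y_def a_def star_scaleR star_power sa)
  have "(\<Sum>i\<le>k. a i * a (k - i)) = ((1::real) gchoose k) *\<^sub>R x ^ k" for k
  proof -
    have "(\<Sum>i\<le>k. a i * a (k - i)) = (\<Sum>i\<le>k. (c i * c (k - i)) *\<^sub>R x ^ k)"
      by (intro sum.cong refl) (simp add: a_def mult.commute flip: power_add)
    also have "\<dots> = (\<Sum>i\<le>k. c i * c (k - i)) *\<^sub>R x ^ k" by (simp add: scaleR_sum_left)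
    also have "(\<Sum>i\<le>k. c i * c (k - i)) = (1::real) gchoose k"
      using gbinomial_Vandermonde[of "1/2::real" "1/2" k] by (simp add: c_def atMost_atLeast0)
    finally show ?thesis .
  qed
  then have "(\<lambda>k. ((1::real) gchoose k) *\<^sub>R x ^ k) sums (y * y)"
    using Cauchy_product_sums[OF sn sn] by (simp add: y_def)
  moreover have "(\<lambda>k. ((1::real) gchoose k) *\<^sub>R x ^ k) sums (\<Sum>k<2. ((1::real) gchoose k) *\<^sub>R x ^ k)"
  proof (rule sums_finite)
    fix k :: nat assume "k \<notin> {..<2}"
    then have "(1::real) gchoose k = 0"
      using binomial_gbinomial[of 1 k, where 'a = real] by (simp add: binomial_eq_0)
    then show "((1::real) gchoose k) *\<^sub>R x ^ k = 0" by simp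
  qed simp
  ultimately have "y * y = 1 + x"
    by (auto dest: sums_unique2 simp: numeral_2_eq_2)
  then show ?thesis unfolding cstar_positive_def using y by metis
qed

lemma positive_complex_iff: "cstar_positive (z :: complex) \<longleftrightarrow> Im z = 0 \<and> 0 \<le> Re z"
proof
  assume "cstar_positive z"
  then show "Im z = 0 \<and> 0 \<le> Re z" by (auto simp: cstar_positive_def star_complex_def)
next
  assume "Im z = 0 \<and> 0 \<le> Re z"
  then have "z = star (complex_of_real (sqrt (Re z))) * complex_of_real (sqrt (Re z))"
    by (simp add: star_complex_def complex_eq_iff)
  then show "cstar_positive z" unfolding cstar_positive_def by blast
qed

lemma pu_map_bounded:
  fixes f :: "'a::cstar_algebra \<Rightarrow> complex"
  assumes "pu_map f"
  shows "\<exists>K. \<forall>x. cmod (f x) \<le> K * norm x"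
proof -
  have add: "f (x + y) = f x + f y" and sc: "f (c *\<^sub>C x) = c * f x"
    and pos: "cstar_positive x \<Longrightarrow> cstar_positive (f x)" and one: "f 1 = 1" for x y c
    using assms by (auto simp: pu_map_def clinear_map_def scaleC_complex_def)
  have scR: "f (r *\<^sub>R x) = of_real r * f x" for r x
    using sc[of "of_real r" x] by (simp add: scaleC_complex_of_real)
  have sa1: "cmod (f x) \<le> 1" if "star x = x" "norm x < 1" for x
  proof -
    have "cstar_positive (1 + f x)" using pos[OF positive_one_plus[OF that]] by (simp add: add one)
    moreover have "star ((-1) *\<^sub>R x) = (-1) *\<^sub>R x" using that by (simp only: star_scaleR)
    then have "cstar_positive (1 + f ((-1) *\<^sub>R x))"
      using pos[OF positive_one_plus, of "(-1) *\<^sub>R x"] that unfolding add one by simp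
    ultimately have "Im (f x) = 0" "\<bar>Re (f x)\<bar> \<le> 1"
      unfolding scR by (auto simp: positive_complex_iff)
    then show ?thesis by (simp add: cmod_eq_Re)
  qed
  have sa: "cmod (f x) \<le> 2 * norm x" if "star x = x" for x
  proof (cases "x = 0")
    case True then show ?thesis using scR[of 0 0] by simp
  next
    case False
    have "cmod (f (inverse (2 * norm x) *\<^sub>R x)) \<le> 1"
      by (rule sa1) (use that False in \<open>simp_all add: star_scaleR\<close>)
    then have "inverse (2 * norm x) * cmod (f x) \<le> 1"
      unfolding scR norm_mult norm_of_real by simp
    then show ?thesis using False by (simp add: field_simps)
  qed
  have "cmod (f x) \<le> 4 * norm x" for x
  proof -
    define u where "u = (1/2) *\<^sub>R (x + star x)"
    define v where "v = (- \<i> / 2) *\<^sub>C (x + (-1) *\<^sub>C star x)"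
    have one: "1 *\<^sub>C z = z" for z :: 'a using scaleC_complex_of_real[of 1 z] by simp
    have half: "(1/2) *\<^sub>C z = (1/2) *\<^sub>R z" for z :: 'a
      using scaleC_complex_of_real[of "1/2" z] by simp
    have mhalf: "(-(1/2)) *\<^sub>C z = (-(1/2)) *\<^sub>R z" for z :: 'a
      using scaleC_complex_of_real[of "-(1/2)" z] by simp
    have u: "star u = u" by (simp add: u_def star_scaleR star_add star_star add.commute)
    have v: "star v = v"
      by (simp add: v_def star_scaleC star_add star_star scaleC_add_right scaleC_scaleC add.commute)
    have "\<i> *\<^sub>C v = (1/2) *\<^sub>R x + (-(1/2)) *\<^sub>R star x"
      by (simp add: v_def scaleC_add_right scaleC_scaleC half mhalf)
    then have x: "x = u + \<i> *\<^sub>C v"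
      by (simp add: u_def scaleR_right_distrib flip: scaleR_left_distrib)
    have nu: "norm u \<le> norm x"
      using norm_triangle_ineq[of x "star x"] by (simp add: u_def norm_star)
    have nv: "norm v \<le> norm x"
      using norm_triangle_ineq[of x "(-1) *\<^sub>C star x"]
      by (simp add: v_def norm_star norm_scaleC norm_divide)
    have "cmod (f x) \<le> cmod (f u) + cmod (f v)"
      using norm_triangle_ineq[of "f u" "\<i> * f v"] by (subst x) (simp add: add sc norm_mult)
    also have "\<dots> \<le> 4 * norm x" using sa[OF u] sa[OF v] nu nv by simp
    finally show ?thesis .
  qed
  then show ?thesis by blast
qed

lemma wd_apply_Abs_wdual_pu_map:
  fixes f :: "'a::cstar_algebra \<Rightarrow> complex"
  assumes "pu_map f" shows "wd_apply (Abs_wdual f) = f"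
proof (rule Abs_wdual_inverse)
  show "f \<in> {\<phi>. clinear_map \<phi> \<and> (\<exists>K. \<forall>x. cmod (\<phi> x) \<le> K * norm x)}"
    using assms pu_map_bounded[OF assms] unfolding pu_map_def by blast
qed

lemma wd_apply_image_stat: "wd_apply ` stat = {f. pu_map f}"
proof (intro equalityI subsetI)
  fix f :: "'a \<Rightarrow> complex" assume "f \<in> {f. pu_map f}"
  then have f: "pu_map f" "wd_apply (Abs_wdual f) = f"
    using wd_apply_Abs_wdual_pu_map by auto
  then have "Abs_wdual f \<in> stat" by (simp add: stat_def)
  then show "f \<in> wd_apply ` stat" using f(2) by (metis imageI)
qed (auto simp: stat_def)

lemma wd_apply_stat_map:
  "pu_map f \<Longrightarrow> \<phi> \<in> stat \<Longrightarrow> wd_apply (stat_map f \<phi>) = wd_apply \<phi> \<circ> f"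
  by (simp add: stat_map_def stat_def wd_apply_Abs_wdual_pu_map pu_map_comp)

end

theory Submission
  imports Defs
begin

text \<open>
  Functoriality is a pointwise verification, and compactness of the state space is the
  Banach-Alaoglu argument: states are uniformly bounded, so they form a closed subset of a product
  of discs (\<open>compact_stat\<close>). The content of the theorem is that the order and the norm of
  the self-adjoint part of a C*-algebra can be read off from the states, and that
  every continuous affine real function on the state space is evaluation at a self-adjoint element.

  \<^bold>\<open>States determine the order.\<close> States are required to be nonnegative on the elements
  \<open>star y * y\<close>, so a Hahn-Banach separation can only recover the closed convex cone
  generated by these elements. That this cone contains nothing but elements \<open>star y * y\<close> is the
  theorem of Fukamiya, Kelley and Vaught. It is reached here without spectral theory. The predicate
  \<open>nonneg_el\<close> describes positivity by an inequality between norms, which makes the positive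
  elements visibly a convex cone; the binomial series shows that they have square roots, and a single
  estimate, \<open>self_adjoint_le_sum_squares\<close>, yields that squares of self-adjoint elements
  belong to the cone, that the cone is closed, and that the order controls the norm. The decisive step
  \<open>nonneg_el_star_mult_self\<close> then follows from polynomial identities. With the cone
  identified, \<open>hahn_banach_cone\<close> produces a state that is negative at any given
  self-adjoint element outside the cone. Hence states separate points (faithfulness), detect
  positivity, and compute the norm of self-adjoint elements.

  \<^bold>\<open>Affine functions are evaluations (Kadison).\<close> Let \<open>g\<close> be continuous and
  affine on the state space, and \<open>e > 0\<close>. By compactness, finitely many self-adjoint elements
  suffice for the states that agree on them to have values of \<open>g\<close> within \<open>2 * e\<close> of each
  other. A Hahn-Banach argument modulo the common kernel of these finitely many evaluations gives a linear
  combination of them that is within \<open>e\<close> of \<open>g\<close> everywhere. For \<open>e\<close> tending to zero the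
  resulting elements form a Cauchy sequence, because states compute the norm, and its limit represents
  \<open>g\<close>.

  \<^bold>\<open>Fullness.\<close> Given a continuous affine \<open>h\<close> between state spaces and an element
  \<open>a\<close>, the function \<open>\<phi> \<mapsto> h \<phi> a\<close> is evaluation at a unique element \<open>f a\<close>. Since states
  separate points and detect positivity, \<open>f\<close> inherits linearity, unitality and positivity
  from the states \<open>h \<phi>\<close>.
\<close>

section \<open>Self-adjoint elements\<close>

lemma scaleC_one [simp]: "1 *\<^sub>C x = (x :: 'a::cstar_algebra)"
  using scaleC_complex_of_real[of 1 x] by simp

lemma scaleC_zero_left [simp]: "0 *\<^sub>C x = (0 :: 'a::cstar_algebra)"
  using scaleC_complex_of_real[of 0 x] by simp

lemma scaleC_zero_right [simp]: "c *\<^sub>C (0 :: 'a::cstar_algebra) = 0"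
  using scaleC_add_right[of c "0::'a" 0] by simp

lemma scaleC_minus_left [simp]: "(- c) *\<^sub>C x = - (c *\<^sub>C (x :: 'a::cstar_algebra))"
  using scaleC_add_left[of c "- c" x] by (simp add: eq_neg_iff_add_eq_0 add.commute)

lemma scaleC_minus_right [simp]: "c *\<^sub>C (- x) = - (c *\<^sub>C (x :: 'a::cstar_algebra))"
  using scaleC_add_right[of c x "- x"] by (simp add: eq_neg_iff_add_eq_0 add.commute)

lemma scaleC_diff_right: "c *\<^sub>C (x - y) = c *\<^sub>C x - c *\<^sub>C (y :: 'a::cstar_algebra)"
  using scaleC_add_right[of c x "- y"] by simp

lemma scaleC_scaleR: "c *\<^sub>C (r *\<^sub>R x) = r *\<^sub>R (c *\<^sub>C (x :: 'a::cstar_algebra))"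
  by (metis mult.commute scaleC_complex_of_real scaleC_scaleC)

lemma star_minus: "star (- x) = - star (x :: 'a::cstar_algebra)"
  using star_scaleR[of "-1" x] by simp

lemma star_diff: "star (x - y) = star x - star (y :: 'a::cstar_algebra)"
  using star_add[of x "- y"] by (simp add: star_minus)

lemma norm_one_le: "norm (1 :: 'a::cstar_algebra) \<le> 1"
proof -
  have "norm (1::'a) * norm (1::'a) = norm (1::'a)"
    using cstar_identity[of "1::'a"] by (simp add: power2_eq_square)
  then show ?thesis by (metis mult_cancel_right1 order_refl zero_le_one)
qed

lemma norm_mult_star: "norm (x * star x) = (norm (x :: 'a::cstar_algebra))\<^sup>2"
  using cstar_identity[of "star x"] by (simp add: star_star norm_star)

lemma norm_mult_self_adjoint: "star x = x \<Longrightarrow> norm (x * x) = (norm (x :: 'a::cstar_algebra))\<^sup>2"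
  using cstar_identity[of x] by simp

lemma cartesian_decomposition:
  fixes x :: "'a::cstar_algebra"
  obtains u v where "star u = u" "star v = v" "x = u + \<i> *\<^sub>C v" "norm u \<le> norm x" "norm v \<le> norm x"
proof
  define u where "u = (1/2) *\<^sub>R (x + star x)"
  define v where "v = (1/2) *\<^sub>R ((- \<i>) *\<^sub>C (x - star x))"
  show "star u = u" by (simp add: u_def star_scaleR star_add star_star add.commute)
  show "star v = v"
    unfolding v_def star_scaleR star_scaleC star_diff star_star
    by (simp add: scaleC_diff_right scaleR_diff_right)
  have "\<i> *\<^sub>C v = (1/2) *\<^sub>R (x - star x)"
    by (simp add: v_def scaleC_scaleR scaleC_scaleC scaleC_diff_right scaleR_diff_right)
  then show "x = u + \<i> *\<^sub>C v"
    by (simp add: u_def scaleR_add_right[symmetric] scaleR_2[symmetric])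
  show "norm u \<le> norm x"
    using norm_triangle_ineq[of x "star x"] by (simp add: u_def norm_star)
  show "norm v \<le> norm x"
    using norm_triangle_ineq4[of x "star x"] by (simp add: v_def norm_star norm_scaleC)
qed

text \<open>
  The real part of \<open>s + \<i> *\<^sub>C w\<close> has at most the norm of that element, which the C*-identity
  computes. This one inequality replaces the comparison of spectra throughout the study of the
  positive cone.
\<close>

lemma self_adjoint_le_sum_squares:
  fixes s w :: "'a::cstar_algebra"
  assumes "star s = s" "star w = w" "s * w = w * s"
  shows "(norm s)\<^sup>2 \<le> norm (s * s + w * w)"
proof -
  define u where "u = s + \<i> *\<^sub>C w"
  have su: "star u = s - \<i> *\<^sub>C w" using assms by (simp add: u_def star_add star_scaleC)
  have "star u * u = s * s + w * w"
    unfolding su using assms(3)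
    by (simp add: u_def algebra_simps scaleC_add_right scaleC_diff_right mult_scaleC_left mult_scaleC_right scaleC_scaleC)
  then have "(norm u)\<^sup>2 = norm (s * s + w * w)" using cstar_identity[of u] by simp
  moreover have "norm s \<le> norm u"
  proof -
    have "2 *\<^sub>R s = u + star u" unfolding su by (simp add: u_def scaleR_2)
    then have "2 * norm s \<le> norm u + norm (star u)"
      by (metis abs_numeral norm_scaleR norm_triangle_ineq)
    then show ?thesis by (simp add: norm_star)
  qed
  ultimately show ?thesis by (metis norm_ge_zero power_mono)
qed

section \<open>Square roots by the binomial series\<close>

text \<open>
  From the second one on, the coefficients of the power series of \<open>sqrt (1 - x)\<close> at \<open>0\<close> are
  nonpositive, so their absolute values telescope to \<open>1\<close> minus a partial sum of the series at
  \<open>x = 1\<close>. The partial sums are again binomial coefficients, of visible sign. Hence the binomial series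
  converges absolutely up to and including radius \<open>1\<close>.
\<close>

lemma sum_abs_gbinomial_half_le: "(\<Sum>k=1..n. \<bar>(1/2 :: real) gchoose k\<bar>) \<le> 1"
proof -
  define d where "d k = ((1/2 :: real) gchoose k) * (-1) ^ k" for k
  have d0: "d 0 = 1" by (simp add: d_def)
  have dS: "d (Suc k) = d k * ((real k - 1/2) / (real k + 1))" for k
  proof -
    have eq: "(1/2 :: real) gchoose Suc k = ((1/2) gchoose k) * ((1/2 - real k) / (real k + 1))"
      using gbinomial_mult_1[of "1/2::real" k] by (simp add: field_simps)
    show ?thesis unfolding d_def eq by (simp add: field_simps)
  qed
  have neg: "d (Suc k) \<le> 0" for k
  proof (induction k)
    case (Suc k)
    have "0 \<le> (real (Suc k) - 1/2) / (real (Suc k) + 1)" by simp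
    then show ?case using Suc dS[of "Suc k"] by (metis mult_nonpos_nonneg)
  qed (simp add: dS d0)
  have pos: "0 \<le> (-1) ^ k * ((- 1/2 :: real) gchoose k)" for k
  proof (induction k)
    case (Suc k)
    have eq: "(- 1/2 :: real) gchoose Suc k = ((- 1/2) gchoose k) * ((- 1/2 - real k) / (real k + 1))"
      using gbinomial_mult_1[of "-1/2::real" k] by (simp add: field_simps)
    have "(-1) ^ Suc k * ((- 1/2 :: real) gchoose Suc k) =
        ((-1) ^ k * ((- 1/2 :: real) gchoose k)) * ((real k + 1/2) / (real k + 1))"
      unfolding eq by (simp add: field_simps)
    moreover have "0 \<le> (real k + 1/2) / (real k + 1)" by simp
    ultimately show ?case using Suc by (metis mult_nonneg_nonneg)
  qed simp
  have "\<bar>(1/2 :: real) gchoose k\<bar> = - d k" if k: "k \<in> {1..n}" for k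
  proof -
    obtain j where "k = Suc j" using k by (cases k) auto
    then have "\<bar>d k\<bar> = - d k" using neg[of j] by simp
    then show ?thesis by (simp add: d_def abs_mult)
  qed
  then have "(\<Sum>k=1..n. \<bar>(1/2 :: real) gchoose k\<bar>) = (\<Sum>k=1..n. - d k)"
    by (rule sum.cong[OF refl])
  also have "\<dots> = 1 - (\<Sum>k\<le>n. d k)"
    using sum.atLeast_Suc_atMost[of 0 n d] by (simp add: sum_negf d0 atMost_atLeast0)
  also have "(\<Sum>k\<le>n. d k) = (-1) ^ n * ((- 1/2 :: real) gchoose n)"
    using gbinomial_sum_lower_neg[of "1/2::real" n] by (simp add: d_def)
  finally show ?thesis using pos[of n] by linarith
qed

text \<open>
  The boundary case \<open>norm x = 1\<close> is essential: it gives square roots of all positive elements,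
  also of those that are not invertible. The bound on \<open>1 - y\<close> says that the root is again positive.
\<close>

lemma sqrt_one_plus:
  fixes x :: "'a::cstar_algebra"
  assumes sa: "star x = x" and n: "norm x \<le> 1"
  obtains y where "star y = y" "y * y = 1 + x" "norm (1 - y) \<le> 1"
    "\<And>w. w * x = x * w \<Longrightarrow> w * y = y * w"
proof
  define c where "c = (\<lambda>n. (1/2 :: real) gchoose n)"
  define a where "a = (\<lambda>n. c n *\<^sub>R x ^ n)"
  have npow: "norm (x ^ k) \<le> 1" for k
  proof -
    have "norm (x ^ k) \<le> norm (1 :: 'a) * norm x ^ k" by (rule norm_power_le)
    also have "\<dots> \<le> 1 * 1"
      using n by (intro mult_mono norm_one_le power_le_one) auto
    finally show ?thesis by simp
  qed
  have le: "norm (a k) \<le> \<bar>c k\<bar>" for k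
    using mult_left_mono[OF npow[of k], of "\<bar>c k\<bar>"] by (simp add: a_def)
  have "summable (\<lambda>k. \<bar>c k\<bar>)"
  proof (rule bounded_imp_summable)
    show "(\<Sum>k\<le>n. \<bar>c k\<bar>) \<le> 2" for n
      using sum.atLeast_Suc_atMost[of 0 n "\<lambda>k. \<bar>c k\<bar>"] sum_abs_gbinomial_half_le[of n]
      by (simp add: c_def atMost_atLeast0)
  qed simp
  then have sn: "summable (\<lambda>k. norm (a k))"
    by (rule summable_comparison_test'[where N = 0]) (simp only: real_norm_def abs_norm_cancel le)
  then have s: "summable a" by (rule summable_norm_cancel)
  define y where "y = (\<Sum>k. a k)"
  have "star y = (\<Sum>k. star (a k))"
    unfolding y_def by (rule bounded_linear.suminf[OF bounded_linear_star s])
  then show "star y = y" by (simp add: y_def a_def star_scaleR star_power sa)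
  \<comment> \<open>Vandermonde: the square of the binomial series of exponent 1/2 is the one of exponent 1.\<close>
  have "(\<Sum>i\<le>k. a i * a (k - i)) = ((1::real) gchoose k) *\<^sub>R x ^ k" for k
  proof -
    have "(\<Sum>i\<le>k. a i * a (k - i)) = (\<Sum>i\<le>k. (c i * c (k - i)) *\<^sub>R x ^ k)"
      by (intro sum.cong refl) (simp add: a_def mult.commute flip: power_add)
    also have "\<dots> = (\<Sum>i\<le>k. c i * c (k - i)) *\<^sub>R x ^ k" by (simp add: scaleR_sum_left)
    also have "(\<Sum>i\<le>k. c i * c (k - i)) = (1::real) gchoose k"
      using gbinomial_Vandermonde[of "1/2::real" "1/2" k] by (simp add: c_def atMost_atLeast0)
    finally show ?thesis .
  qed
  then have "(\<lambda>k. ((1::real) gchoose k) *\<^sub>R x ^ k) sums (y * y)"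
    using Cauchy_product_sums[OF sn sn] by (simp add: y_def)
  moreover have "(\<lambda>k. ((1::real) gchoose k) *\<^sub>R x ^ k) sums (\<Sum>k<2. ((1::real) gchoose k) *\<^sub>R x ^ k)"
  proof (rule sums_finite)
    fix k :: nat assume "k \<notin> {..<2}"
    then have "(1::real) gchoose k = 0"
      using binomial_gbinomial[of 1 k, where 'a = real] by (simp add: binomial_eq_0)
    then show "((1::real) gchoose k) *\<^sub>R x ^ k = 0" by simp
  qed simp
  ultimately show "y * y = 1 + x"
    by (auto dest: sums_unique2 simp: numeral_2_eq_2)
  show "norm (1 - y) \<le> 1"
  proof (rule Lim_norm_ubound)
    show "(\<lambda>n. 1 - (\<Sum>k\<le>n. a k)) \<longlonglongrightarrow> 1 - y"
      unfolding y_def using summable_LIMSEQ'[OF s] by (intro tendsto_intros)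
    show "\<forall>\<^sub>F n in sequentially. norm (1 - (\<Sum>k\<le>n. a k)) \<le> 1"
    proof (intro always_eventually allI)
      fix n
      have "1 - (\<Sum>k\<le>n. a k) = - (\<Sum>k=1..n. a k)"
        using sum.atLeast_Suc_atMost[of 0 n a] by (simp add: a_def c_def atMost_atLeast0)
      also have "norm \<dots> \<le> (\<Sum>k=1..n. \<bar>c k\<bar>)"
        unfolding norm_minus_cancel by (intro sum_norm_le le)
      finally show "norm (1 - (\<Sum>k\<le>n. a k)) \<le> 1"
        using sum_abs_gbinomial_half_le[of n] by (simp add: c_def)
    qed
  qed simp
  fix w assume w: "w * x = x * w"
  have wp: "w * x ^ k = x ^ k * w" for k
    by (induction k) (simp_all, metis mult.assoc w)
  have "w * y = (\<Sum>k. w * a k)" unfolding y_def by (rule suminf_mult[OF s, symmetric])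
  also have "\<dots> = (\<Sum>k. a k * w)" by (simp add: a_def wp)
  also have "\<dots> = y * w" unfolding y_def by (rule suminf_mult2[OF s, symmetric])
  finally show "w * y = y * w" .
qed

section \<open>The positive cone\<close>

text \<open>
  For self-adjoint \<open>a\<close> and \<open>t \<ge> norm a\<close>, the norm inequality says exactly that the spectrum of
  \<open>a\<close> is contained in the nonnegative reals. Quantifying existentially over \<open>t\<close> turns
  closure under addition into the triangle inequality.
\<close>

definition nonneg_el :: "'a::cstar_algebra \<Rightarrow> bool" where
  "nonneg_el a \<longleftrightarrow> star a = a \<and> (\<exists>t\<ge>0. norm (t *\<^sub>R 1 - a) \<le> t)"

lemma nonneg_el_self_adjoint: "nonneg_el a \<Longrightarrow> star a = a"
  by (simp add: nonneg_el_def)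

lemma nonneg_el_add:
  assumes "nonneg_el a" "nonneg_el b" shows "nonneg_el (a + b)"
proof -
  obtain s t where s: "s \<ge> 0" "norm (s *\<^sub>R 1 - a) \<le> s" and t: "t \<ge> 0" "norm (t *\<^sub>R 1 - b) \<le> t"
    using assms by (auto simp: nonneg_el_def)
  have "(s + t) *\<^sub>R 1 - (a + b) = (s *\<^sub>R 1 - a) + (t *\<^sub>R 1 - b)"
    by (simp add: scaleR_left_distrib)
  then have "norm ((s + t) *\<^sub>R 1 - (a + b)) \<le> s + t"
    using s t norm_triangle_mono by metis
  then show ?thesis
    using assms s t by (auto simp: nonneg_el_def star_add intro!: exI[of _ "s + t"])
qed

lemma nonneg_el_scaleR:
  assumes "nonneg_el a" "0 \<le> r" shows "nonneg_el (r *\<^sub>R a)"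
proof -
  obtain t where t: "t \<ge> 0" "norm (t *\<^sub>R 1 - a) \<le> t"
    using assms by (auto simp: nonneg_el_def)
  have "norm ((r * t) *\<^sub>R 1 - r *\<^sub>R a) = r * norm (t *\<^sub>R 1 - a)"
    using assms(2) by (simp flip: scaleR_scaleR scaleR_diff_right)
  also have "\<dots> \<le> r * t" using t assms by (intro mult_left_mono)
  finally show ?thesis
    using assms t by (auto simp: nonneg_el_def star_scaleR intro!: exI[of _ "r * t"])
qed

lemma nonneg_el_scaleR_one: "0 \<le> r \<Longrightarrow> nonneg_el (r *\<^sub>R 1)"
  by (auto simp: nonneg_el_def star_scaleR intro!: exI[of _ r])

lemma nonneg_el_norm_minus:
  assumes "star x = x" "norm x \<le> t" shows "nonneg_el (t *\<^sub>R 1 - x)"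
  unfolding nonneg_el_def
proof (intro conjI exI)
  show "star (t *\<^sub>R 1 - x) = t *\<^sub>R 1 - x" using assms by (simp add: star_diff star_scaleR)
  show "0 \<le> t" using assms norm_ge_zero order_trans by blast
  show "norm (t *\<^sub>R 1 - (t *\<^sub>R 1 - x)) \<le> t" using assms by simp
qed

lemma nonneg_el_sqrt:
  fixes a :: "'a::cstar_algebra"
  assumes "nonneg_el a"
  obtains s where "nonneg_el s" "s * s = a" "\<And>w. w * a = a * w \<Longrightarrow> w * s = s * w"
proof -
  obtain t where t: "t \<ge> 0" "norm (t *\<^sub>R 1 - a) \<le> t" and sa: "star a = a"
    using assms by (auto simp: nonneg_el_def)
  show ?thesis
  proof (cases "t = 0")
    case True
    then have "a = 0" using t by simp
    then show ?thesis using nonneg_el_scaleR_one[of 0] by (intro that[of 0]) auto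
  next
    case False
    \<comment> \<open>Then \<open>norm x \<le> 1\<close> and \<open>a = t *\<^sub>R (1 + x)\<close>.\<close>
    define x where "x = (1/t) *\<^sub>R a - 1"
    have "x = (- 1/t) *\<^sub>R (t *\<^sub>R 1 - a)" using False by (simp add: x_def scaleR_diff_right)
    then have "norm x = (1/t) * norm (t *\<^sub>R 1 - a)" using t by simp
    also have "\<dots> \<le> (1/t) * t" using t by (intro mult_left_mono) auto
    finally have nx: "norm x \<le> 1" using False by simp
    have "star x = x" by (simp add: x_def star_diff star_scaleR sa)
    from sqrt_one_plus[OF this nx] obtain y where y: "star y = y" "y * y = 1 + x" "norm (1 - y) \<le> 1"
      "\<And>w. w * x = x * w \<Longrightarrow> w * y = y * w" by metis
    show ?thesis
    proof (rule that)
      show "nonneg_el (sqrt t *\<^sub>R y)"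
        using y(1,3) t by (intro nonneg_el_scaleR) (auto simp: nonneg_el_def intro!: exI[of _ 1])
      show "sqrt t *\<^sub>R y * sqrt t *\<^sub>R y = a"
        using y(2) t False by (simp add: x_def)
      show "w * sqrt t *\<^sub>R y = sqrt t *\<^sub>R y * w" if "w * a = a * w" for w
      proof -
        have "w * x = x * w" using that by (simp add: x_def algebra_simps)
        from y(4)[OF this] show ?thesis by simp
      qed
    qed
  qed
qed

text \<open>
  After scaling \<open>s\<close> to \<open>r\<close> of norm at most \<open>1\<close>, a root \<open>y\<close> of \<open>1 - r * r\<close> commutes with
  \<open>r\<close>, and the squares of the two sum to \<open>1\<close>. So \<open>y\<close> is a contraction, and
  \<open>y * y = 1 - r * r\<close> is the inequality that defines positivity of \<open>r * r\<close>.
\<close>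

lemma nonneg_el_square:
  assumes sa: "star s = s" shows "nonneg_el (s * s)"
proof -
  define t where "t = (norm s)\<^sup>2 + 1"
  have t: "t > 0" by (simp add: t_def add_nonneg_pos)
  define r where "r = (1 / sqrt t) *\<^sub>R s"
  have r: "star r = r" by (simp add: r_def star_scaleR sa)
  have rr: "r * r = (1 / t) *\<^sub>R (s * s)" using t by (simp add: r_def)
  have "norm (- (r * r)) = (1 / t) * (norm s)\<^sup>2"
    using t by (simp add: rr norm_mult_self_adjoint sa)
  also have "\<dots> \<le> 1" using t by (simp add: t_def field_simps)
  finally have n: "norm (- (r * r)) \<le> 1" .
  have "star (- (r * r)) = - (r * r)" by (simp add: star_minus star_mult r)
  from sqrt_one_plus[OF this n] obtain y where y: "star y = y" "y * y = 1 + - (r * r)"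
      "\<And>w. w * - (r * r) = - (r * r) * w \<Longrightarrow> w * y = y * w" by metis
  have "y * r = r * y" using y(3)[of r] by (simp add: mult.assoc)
  then have "(norm y)\<^sup>2 \<le> norm (y * y + r * r)"
    by (intro self_adjoint_le_sum_squares y(1) r)
  also have "y * y + r * r = 1" by (simp add: y(2))
  also note norm_one_le
  finally have "norm (y * y) \<le> 1" unfolding norm_mult_self_adjoint[OF y(1)] .
  then have "norm (1 - (1 / t) *\<^sub>R (s * s)) \<le> 1" by (simp add: y(2) rr)
  moreover have "t *\<^sub>R 1 - s * s = t *\<^sub>R (1 - (1 / t) *\<^sub>R (s * s))"
    using t by (simp add: scaleR_diff_right)
  ultimately have "norm (t *\<^sub>R 1 - s * s) \<le> t" using t by (simp add: mult_left_le)
  then show ?thesis using t sa by (auto simp: nonneg_el_def star_mult intro!: exI[of _ t])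
qed

lemma norm_square_le_of_order:
  fixes x :: "'a::cstar_algebra"
  assumes sa: "star x = x" and t: "0 \<le> t" and n: "nonneg_el (t *\<^sub>R 1 - x * x)"
  shows "(norm x)\<^sup>2 \<le> t"
proof -
  obtain w where w: "nonneg_el w" "w * w = t *\<^sub>R 1 - x * x"
    "\<And>v. v * (t *\<^sub>R 1 - x * x) = (t *\<^sub>R 1 - x * x) * v \<Longrightarrow> v * w = w * v"
    using nonneg_el_sqrt[OF n] by blast
  have "x * w = w * x" by (rule w(3)) (simp add: algebra_simps)
  then have "(norm x)\<^sup>2 \<le> norm (x * x + w * w)"
    using w(1) sa by (intro self_adjoint_le_sum_squares) (auto simp: nonneg_el_self_adjoint)
  also have "\<dots> = t * norm (1 :: 'a)" using t by (simp add: w(2))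
  also have "\<dots> \<le> t" using t norm_one_le[where 'a='a] by (simp add: mult_left_le)
  finally show ?thesis .
qed

text \<open>
  The roots of \<open>t - x\<close> and \<open>t + x\<close> commute, so their product squares to \<open>t * t - x * x\<close>,
  which is therefore positive.
\<close>

lemma norm_le_of_order:
  fixes x :: "'a::cstar_algebra"
  assumes sa: "star x = x" and t: "0 \<le> t"
    and n: "nonneg_el (t *\<^sub>R 1 - x)" "nonneg_el (t *\<^sub>R 1 + x)"
  shows "norm x \<le> t"
proof -
  obtain s where s: "nonneg_el s" "s * s = t *\<^sub>R 1 - x"
    "\<And>v. v * (t *\<^sub>R 1 - x) = (t *\<^sub>R 1 - x) * v \<Longrightarrow> v * s = s * v"
    using nonneg_el_sqrt[OF n(1)] by blast
  obtain w where w: "nonneg_el w" "w * w = t *\<^sub>R 1 + x"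
    "\<And>v. v * (t *\<^sub>R 1 + x) = (t *\<^sub>R 1 + x) * v \<Longrightarrow> v * w = w * v"
    using nonneg_el_sqrt[OF n(2)] by blast
  have "x * s = s * x" by (rule s(3)) (simp add: algebra_simps)
  then have sw: "s * w = w * s" by (intro w(3)) (simp add: algebra_simps)
  then have "(s * w) * (s * w) = (s * s) * (w * w)" by (metis mult.assoc)
  also have "\<dots> = (t * t) *\<^sub>R 1 - x * x" by (simp add: s(2) w(2) algebra_simps)
  finally have eq: "(s * w) * (s * w) = (t * t) *\<^sub>R 1 - x * x" .
  have "star (s * w) = s * w" using s(1) w(1) sw by (simp add: star_mult nonneg_el_self_adjoint)
  from nonneg_el_square[OF this] have "(norm x)\<^sup>2 \<le> t * t"
    unfolding eq using sa t by (intro norm_square_le_of_order) auto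
  then show ?thesis using t by (simp add: power2_eq_square[symmetric] power2_le_iff_abs_le)
qed

lemma nonneg_el_antisym:
  assumes "nonneg_el a" "nonneg_el (- a)" shows "a = 0"
  using norm_le_of_order[of a 0] assms by (simp add: nonneg_el_self_adjoint)

text \<open>
  The existential quantifier in the definition of \<^const>\<open>nonneg_el\<close> may be replaced by the
  explicit radii \<open>t \<ge> norm a\<close>. With a radius that is the same for nearby elements the condition
  becomes closed.
\<close>

lemma nonneg_el_norm_diff:
  assumes "nonneg_el a" "norm a \<le> t" shows "norm (t *\<^sub>R 1 - a) \<le> t"
proof (rule norm_le_of_order)
  have t: "0 \<le> t" using assms norm_ge_zero order_trans by blast
  show "0 \<le> t" by (rule t)
  have sa: "star a = a" using assms by (simp add: nonneg_el_self_adjoint)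
  show "star (t *\<^sub>R 1 - a) = t *\<^sub>R 1 - a" by (simp add: star_diff star_scaleR sa)
  show "nonneg_el (t *\<^sub>R 1 - (t *\<^sub>R 1 - a))" using assms by simp
  show "nonneg_el (t *\<^sub>R 1 + (t *\<^sub>R 1 - a))"
    by (intro nonneg_el_add nonneg_el_scaleR_one nonneg_el_norm_minus t sa assms)
qed

lemma nonneg_el_closed:
  fixes a :: "'a::cstar_algebra"
  assumes "\<And>e. 0 < e \<Longrightarrow> nonneg_el (a + e *\<^sub>R 1)"
  shows "nonneg_el a"
  unfolding nonneg_el_def
proof (intro conjI exI)
  have "star (a + 1 *\<^sub>R 1) = a + 1 *\<^sub>R 1" by (rule nonneg_el_self_adjoint, rule assms) simp
  then show "star a = a" by (simp add: star_add)
  show "0 \<le> norm a + 1" by simp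
  show "norm ((norm a + 1) *\<^sub>R 1 - a) \<le> norm a + 1"
  proof (rule field_le_epsilon)
    fix e :: real assume e: "0 < e"
    define d where "d = min e 1"
    have d: "0 < d" "d \<le> e" "d \<le> 1" using e by (auto simp: d_def)
    have nd: "norm (d *\<^sub>R (1::'a)) \<le> d"
      using d norm_one_le[where 'a='a] by (simp add: mult_left_le)
    have "norm (a + d *\<^sub>R 1) \<le> norm a + 1"
      using nd d norm_triangle_ineq[of a "d *\<^sub>R 1"] by linarith
    then have "norm ((norm a + 1) *\<^sub>R 1 - (a + d *\<^sub>R 1)) \<le> norm a + 1"
      using assms d by (intro nonneg_el_norm_diff) auto
    moreover have "norm ((norm a + 1) *\<^sub>R 1 - a) \<le>
        norm ((norm a + 1) *\<^sub>R 1 - (a + d *\<^sub>R 1)) + norm (d *\<^sub>R (1::'a))"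
      using norm_triangle_ineq[of "(norm a + 1) *\<^sub>R 1 - (a + d *\<^sub>R 1)" "d *\<^sub>R 1"] by simp
    ultimately show "norm ((norm a + 1) *\<^sub>R 1 - a) \<le> norm a + 1 + e"
      using nd d by linarith
  qed
qed

text \<open>
  Put \<open>r = - (star z * z)\<close> and \<open>c = z * star z\<close>. Both are positive: the Cartesian parts of
  \<open>z\<close> give \<open>c - r = 2 (u\<^sup>2 + v\<^sup>2)\<close>. Normally one now compares the spectra of
  \<open>star z * z\<close> and \<open>z * star z\<close>; instead, with \<open>T = (norm z)\<^sup>2\<close>, the identity
  \<open>z * (T + r) = (T - c) * z\<close> shows that multiplying \<open>z\<close> by \<open>T + r\<close> scales its norm by at
  most \<open>T\<close>. Taking \<open>star (_) * _\<close> of the left-hand side, this bounds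
  \<open>T\<^sup>2 r + 2 T r\<^sup>2 + r\<^sup>3\<close> by \<open>T\<^sup>3\<close>, whereas already its middle term has norm
  \<open>2 T\<^sup>3\<close>, and all three terms are positive.
\<close>

lemma eq_zero_if_minus_star_mult_self_nonneg:
  fixes z :: "'a::cstar_algebra"
  assumes neg: "nonneg_el (- (star z * z))"
  shows "z = 0"
proof (rule ccontr)
  assume "z \<noteq> 0"
  define r where "r = - (star z * z)"
  define c where "c = z * star z"
  define T where "T = (norm z)\<^sup>2"
  have T: "T > 0" using \<open>z \<noteq> 0\<close> by (simp add: T_def)
  have r: "nonneg_el r" using neg by (simp add: r_def)
  have nr: "norm r = T" by (simp add: r_def T_def cstar_identity)
  have sr: "star r = r" using r by (rule nonneg_el_self_adjoint)
  obtain u v where uv: "star u = u" "star v = v" "z = u + \<i> *\<^sub>C v"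
    using cartesian_decomposition by metis
  have sz: "star z = u - \<i> *\<^sub>C v" using uv by (simp add: star_add star_scaleC)
  have "c = 2 *\<^sub>R (u * u + v * v) + r"
    unfolding c_def r_def sz unfolding uv(3)
    by (simp add: algebra_simps mult_scaleC_left mult_scaleC_right scaleC_scaleC
        scaleC_add_right scaleC_diff_right scaleR_2)
  then have "nonneg_el c"
    using r uv by (auto intro!: nonneg_el_add nonneg_el_scaleR nonneg_el_square)
  moreover have "norm c = T" by (simp add: c_def T_def norm_mult_star)
  ultimately have "norm (T *\<^sub>R 1 - c) \<le> T" by (intro nonneg_el_norm_diff) auto
  define w where "w = T *\<^sub>R 1 + r"
  have "z * w = (T *\<^sub>R 1 - c) * z" by (simp add: w_def c_def r_def algebra_simps)
  then have "norm (z * w) \<le> norm (T *\<^sub>R 1 - c) * norm z" by (simp add: norm_mult_ineq)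
  also have "\<dots> \<le> T * norm z" using \<open>norm (T *\<^sub>R 1 - c) \<le> T\<close> by (intro mult_right_mono) auto
  finally have "(norm (z * w))\<^sup>2 \<le> (T * norm z)\<^sup>2" by (intro power_mono) auto
  then have le: "norm (star (z * w) * (z * w)) \<le> T * T * T"
    by (simp add: cstar_identity power_mult_distrib T_def power2_eq_square ac_simps)
  have sw: "star w = w" by (simp add: w_def star_add star_scaleR sr)
  define E where "E = (T * T) *\<^sub>R r + (2 * T) *\<^sub>R (r * r) + r * (r * r)"
  have "star (z * w) * (z * w) = w * (star z * z) * w" by (simp add: star_mult sw mult.assoc)
  also have "star z * z = - r" by (simp add: r_def)
  also have "w * - r * w = - E"
    by (simp add: w_def E_def algebra_simps scaleR_2 flip: scaleR_scaleR)
  finally have nE: "norm E \<le> T * T * T" using le by simp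
  obtain q where q: "nonneg_el q" "q * q = r" "\<And>w. w * r = r * w \<Longrightarrow> w * q = q * w"
    using nonneg_el_sqrt[OF r] by blast
  have qr: "r * q = q * r" by (rule q(3)) simp
  have sq: "star q = q" using q(1) by (rule nonneg_el_self_adjoint)
  have "(r * q) * (r * q) = r * (r * r)" by (metis q(2) qr mult.assoc)
  moreover have "star (r * q) = r * q" by (simp add: star_mult sq sr qr)
  ultimately have rrr: "nonneg_el (r * (r * r))" using nonneg_el_square[of "r * q"] by simp
  have "star E = E" by (simp add: E_def star_add star_scaleR star_mult sr mult.assoc)
  then have "nonneg_el ((T * T * T) *\<^sub>R 1 - E)" using nE by (rule nonneg_el_norm_minus)
  then have "nonneg_el (((T * T * T) *\<^sub>R 1 - E) + ((T * T) *\<^sub>R r + r * (r * r)))"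
    using T by (intro nonneg_el_add nonneg_el_scaleR r rrr) auto
  also have "((T * T * T) *\<^sub>R 1 - E) + ((T * T) *\<^sub>R r + r * (r * r)) =
      (T * T * T) *\<^sub>R 1 - (sqrt (2 * T) *\<^sub>R r) * (sqrt (2 * T) *\<^sub>R r)"
    using T by (simp add: E_def)
  finally have "(norm (sqrt (2 * T) *\<^sub>R r))\<^sup>2 \<le> T * T * T"
    using T sr by (intro norm_square_le_of_order) (auto simp: star_scaleR)
  then have "2 * (T * T * T) \<le> T * T * T" using T by (simp add: nr power_mult_distrib power2_eq_square)
  then show False using T by simp
qed

text \<open>
  With \<open>a = star y * y\<close> and \<open>p\<close> the absolute value of \<open>a\<close>, the element \<open>m = (p - a) / 2\<close> is the
  negative part of \<open>a\<close>. Then \<open>- star (y * m) * (y * m) = m\<^sup>3\<close> is the square of \<open>q * m\<close> with \<open>q\<close> a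
  root of \<open>p\<close>, hence positive, so the preceding lemma gives \<open>y * m = 0\<close>. It follows that \<open>m = 0\<close>
  and \<open>a = p\<close>.
\<close>

theorem nonneg_el_star_mult_self:
  fixes y :: "'a::cstar_algebra"
  shows "nonneg_el (star y * y)"
proof -
  define a where "a = star y * y"
  have sa: "star a = a" by (simp add: a_def star_mult star_star)
  obtain p where p: "nonneg_el p" "p * p = a * a" "\<And>w. w * (a * a) = (a * a) * w \<Longrightarrow> w * p = p * w"
    using nonneg_el_sqrt[OF nonneg_el_square[OF sa]] by blast
  obtain q where q: "nonneg_el q" "q * q = p" "\<And>w. w * p = p * w \<Longrightarrow> w * q = q * w"
    using nonneg_el_sqrt[OF p(1)] by blast
  have sp: "star p = p" and sq: "star q = q" using p(1) q(1) by (auto simp: nonneg_el_self_adjoint)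
  have ap: "a * p = p * a" by (rule p(3)) (simp add: mult.assoc)
  define m where "m = (1/2) *\<^sub>R (p - a)"
  have sm: "star m = m" by (simp add: m_def star_scaleR star_diff sp sa)
  have mp: "m * p = p * m" by (simp add: m_def algebra_simps ap)
  have mq: "m * q = q * m" by (rule q(3)) (rule mp)
  have mm: "m * m = p * m"
  proof -
    have "(p - a) * (p - a) = 2 *\<^sub>R (p * (p - a))"
      using p(2) ap by (simp add: algebra_simps scaleR_2)
    then show ?thesis by (simp add: m_def)
  qed
  have am: "a * m = - (m * m)"
  proof -
    have "a = p - 2 *\<^sub>R m" by (simp add: m_def)
    then have "a * m = p * m - 2 *\<^sub>R (m * m)" by (metis left_diff_distrib mult_scaleR_left)
    then show ?thesis by (simp add: mm scaleR_2)
  qed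
  have "star (y * m) * (y * m) = m * (a * m)" by (simp add: star_mult sm a_def mult.assoc)
  also have "\<dots> = - (m * (m * m))" by (simp add: am)
  also have "m * (m * m) = (q * m) * (q * m)" by (metis mm mq q(2) mult.assoc)
  finally have "- (star (y * m) * (y * m)) = (q * m) * (q * m)" by simp
  moreover have "star (q * m) = q * m" by (simp add: star_mult sm sq mq)
  ultimately have "y * m = 0"
    using nonneg_el_square eq_zero_if_minus_star_mult_self_nonneg by metis
  then have "a * m = 0" by (simp add: a_def mult.assoc)
  then have "m * m = 0" by (simp add: am)
  then have "m = 0" using norm_mult_self_adjoint[OF sm] by simp
  then have "a = p" by (simp add: m_def)
  then show ?thesis using p(1) by (simp add: a_def)
qed

lemma cstar_positive_iff_nonneg_el: "cstar_positive a \<longleftrightarrow> nonneg_el a"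
proof
  assume "nonneg_el a"
  then obtain s where "nonneg_el s" "s * s = a" using nonneg_el_sqrt by metis
  then have "a = star s * s" by (simp add: nonneg_el_self_adjoint)
  then show "cstar_positive a" unfolding cstar_positive_def by blast
qed (auto simp: cstar_positive_def nonneg_el_star_mult_self)

section \<open>The Hahn-Banach theorem for cones\<close>

text \<open>
  A pair \<open>(x, t)\<close> stands for the constraint \<open>f x \<le> t\<close> on a linear functional \<open>f\<close> that is
  to be found. The constraints implied by positive combinations of others are included, and they are
  consistent at \<open>0\<close>. Such a set is the upper region of a sublinear functional, but stating the
  constraints as a relation avoids computing infima in the applications.
\<close>

definition dominating_cone :: "('v::real_vector \<times> real) set \<Rightarrow> bool" where
  "dominating_cone G \<longleftrightarrow>
     (\<forall>p\<in>G. \<forall>q\<in>G. p + q \<in> G) \<and> (\<forall>r\<ge>0. \<forall>p\<in>G. r *\<^sub>R p \<in> G) \<and> (\<forall>t. (0, t) \<in> G \<longrightarrow> 0 \<le> t)"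

lemma dominating_cone_add:
  "dominating_cone G \<Longrightarrow> (x, s) \<in> G \<Longrightarrow> (y, t) \<in> G \<Longrightarrow> (x + y, s + t) \<in> G"
  unfolding dominating_cone_def by (metis add_Pair)

lemma dominating_cone_scaleR:
  "dominating_cone G \<Longrightarrow> 0 \<le> r \<Longrightarrow> (x, t) \<in> G \<Longrightarrow> (r *\<^sub>R x, r * t) \<in> G"
  unfolding dominating_cone_def by (metis real_scaleR_def scaleR_Pair)

text \<open>
  By Zorn's lemma there is a maximal dominating cone \<open>H \<supseteq> G\<close>; its lower boundary \<open>f\<close> is sublinear.
  Adding the ray through \<open>(- x, - f x)\<close> keeps the constraints consistent, so by maximality this
  pair already lies in \<open>H\<close>. Thus \<open>f (- x) \<le> - f x\<close>, and an odd sublinear functional is linear.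
\<close>

lemma hahn_banach_cone:
  fixes G :: "('v::real_vector \<times> real) set"
  assumes G: "dominating_cone G" and total: "\<And>x. \<exists>t. (x, t) \<in> G"
  obtains f where "linear f" "\<And>x t. (x, t) \<in> G \<Longrightarrow> f x \<le> t"
proof -
  define \<A> where "\<A> = {H. dominating_cone H \<and> G \<subseteq> H}"
  have "\<exists>M\<in>\<A>. \<forall>X\<in>\<A>. M \<subseteq> X \<longrightarrow> X = M"
  proof (rule subset_Zorn)
    fix C assume C: "subset.chain \<A> C"
    show "\<exists>U\<in>\<A>. \<forall>X\<in>C. X \<subseteq> U"
    proof (cases "C = {}")
      case True then show ?thesis using G by (auto simp: \<A>_def)
    next
      case False
      have CA: "X \<in> \<A>" if "X \<in> C" for X using C that by (auto simp: subset.chain_def)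
      have "\<Union>C \<in> \<A>"
        unfolding \<A>_def dominating_cone_def
      proof (intro CollectI conjI ballI allI impI)
        fix p q assume "p \<in> \<Union>C" "q \<in> \<Union>C"
        then obtain X Y where XY: "X \<in> C" "p \<in> X" "Y \<in> C" "q \<in> Y" by blast
        then have "X \<subseteq> Y \<or> Y \<subseteq> X" using C by (auto simp: subset.chain_def)
        then obtain Z where "Z \<in> C" "p \<in> Z" "q \<in> Z" using XY by blast
        then show "p + q \<in> \<Union>C" using CA[of Z] by (auto simp: \<A>_def dominating_cone_def)
      next
        fix r :: real and p assume "0 \<le> r" "p \<in> \<Union>C"
        then obtain X where X: "X \<in> C" "p \<in> X" by blast
        then have "r *\<^sub>R p \<in> X"
          using CA[of X] \<open>0 \<le> r\<close> by (simp add: \<A>_def dominating_cone_def)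
        then show "r *\<^sub>R p \<in> \<Union>C" using X by blast
      next
        fix t assume "(0, t) \<in> \<Union>C"
        then show "0 \<le> t" using CA by (auto simp: \<A>_def dominating_cone_def)
      next
        show "G \<subseteq> \<Union>C" using False CA by (auto simp: \<A>_def)
      qed
      then show ?thesis by blast
    qed
  qed
  then obtain H where H: "dominating_cone H" "G \<subseteq> H"
    and max: "\<And>X. dominating_cone X \<Longrightarrow> H \<subseteq> X \<Longrightarrow> X = H"
    unfolding \<A>_def by (smt (verit) mem_Collect_eq subset_trans)
  have H0: "0 \<le> t" if "(0, t) \<in> H" for t using H(1) that by (simp add: dominating_cone_def)
  note add = dominating_cone_add[OF H(1)] and scale = dominating_cone_scaleR[OF H(1)]
  have zero: "(0, 0) \<in> H" using scale[of 0] total H(2) by fastforce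
  define f where "f x = Inf {t. (x, t) \<in> H}" for x
  have ne: "{t. (x, t) \<in> H} \<noteq> {}" for x using total H(2) by blast
  have bdd: "bdd_below {t. (x, t) \<in> H}" for x
  proof -
    obtain s where s: "(- x, s) \<in> H" using ne by blast
    have "- s \<le> t" if "(x, t) \<in> H" for t
      using H0[of "t + s"] add[OF that s] by simp
    then show ?thesis by (auto simp: bdd_below_def)
  qed
  have le: "f x \<le> t" if "(x, t) \<in> H" for x t
    unfolding f_def using that bdd by (intro cInf_lower) auto
  have greatest: "c \<le> f x" if "\<And>t. (x, t) \<in> H \<Longrightarrow> c \<le> t" for x c
    unfolding f_def using that ne by (intro cInf_greatest) auto
  have sub: "f (x + y) \<le> f x + f y" for x y
  proof -
    have "f (x + y) - t \<le> f x" if t: "(y, t) \<in> H" for t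
    proof (rule greatest)
      show "f (x + y) - t \<le> s" if "(x, s) \<in> H" for s
        using le[OF add[OF that t]] by simp
    qed
    then have "f (x + y) - f x \<le> t" if "(y, t) \<in> H" for t
      using that by (simp add: diff_le_eq add.commute)
    then have "f (x + y) - f x \<le> f y" by (rule greatest)
    then show ?thesis by simp
  qed
  have hom: "f (r *\<^sub>R x) \<le> r * f x" if "0 < r" for r x
  proof -
    have "f (r *\<^sub>R x) / r \<le> f x"
    proof (rule greatest)
      show "f (r *\<^sub>R x) / r \<le> t" if "(x, t) \<in> H" for t
        using \<open>0 < r\<close> le[OF scale[OF _ that, of r]] by (simp add: divide_le_eq mult.commute)
    qed
    then show ?thesis using that by (simp add: divide_le_eq mult.commute)
  qed
  have odd_mem: "(- x, - f x) \<in> H" for x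
  proof -
    \<comment> \<open>The cone spanned by \<open>H\<close> and the ray through \<open>(- x, - f x)\<close>.\<close>
    define X where "X = {(y - s *\<^sub>R x, t - s * f x) | y s t. (y, t) \<in> H \<and> 0 \<le> s}"
    have XI: "(y - s *\<^sub>R x, t - s * f x) \<in> X" if "(y, t) \<in> H" "0 \<le> s" for y s t
      using that by (auto simp: X_def)
    have "dominating_cone X"
      unfolding dominating_cone_def
    proof (intro conjI ballI allI impI)
      fix p q assume "p \<in> X" "q \<in> X"
      then obtain y s t y' s' t' where
        "p = (y - s *\<^sub>R x, t - s * f x)" "(y, t) \<in> H" "0 \<le> s"
        "q = (y' - s' *\<^sub>R x, t' - s' * f x)" "(y', t') \<in> H" "0 \<le> s'"
        unfolding X_def by blast
      then show "p + q \<in> X"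
        using XI[OF add, of y t y' t' "s + s'"] by (simp add: algebra_simps)
    next
      fix r :: real and p assume r: "0 \<le> r" and "p \<in> X"
      then obtain y s t where
        "p = (y - s *\<^sub>R x, t - s * f x)" "(y, t) \<in> H" "0 \<le> s"
        unfolding X_def by blast
      then show "r *\<^sub>R p \<in> X"
        using r XI[OF scale, of r y t "r * s"] by (simp add: algebra_simps)
    next
      fix t assume "(0, t) \<in> X"
      then obtain s u where su: "(s *\<^sub>R x, u) \<in> H" "0 \<le> s" "t = u - s * f x"
        unfolding X_def by auto
      show "0 \<le> t"
      proof (cases "s = 0")
        case True
        then show ?thesis using su H0[of u] by simp
      next
        case False
        then have "(x, u / s) \<in> H"
          using su scale[of "1 / s" "s *\<^sub>R x" u] by simp
        then have "f x \<le> u / s" by (rule le)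
        then show ?thesis using su False by (simp add: field_simps)
      qed
    qed
    moreover have "H \<subseteq> X" using XI[of _ _ 0] by auto
    ultimately have "X = H" by (rule max)
    then show ?thesis using XI[OF zero, of 1] by simp
  qed
  have neg: "f (- x) = - f x" for x
  proof (rule antisym)
    show "f (- x) \<le> - f x" by (rule le[OF odd_mem])
    have "0 \<le> f 0" by (rule greatest) (rule H0)
    then show "- f x \<le> f (- x)" using sub[of x "- x"] by simp
  qed
  have "linear f"
  proof (rule linearI)
    show "f (x + y) = f x + f y" for x y
      using sub[of x y] sub[of "- x" "- y"] neg[of x] neg[of y] neg[of "x + y"]
      by (simp add: algebra_simps)
    have pos: "f (r *\<^sub>R x) = r * f x" if "0 < r" for r x
      using hom[OF that, of x] hom[OF that, of "- x"] neg[of "r *\<^sub>R x"] neg[of x] by simp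
    show "f (r *\<^sub>R x) = r *\<^sub>R f x" for r x
    proof (cases "r = 0")
      case True
      have "f 0 = 0" using neg[of 0] unfolding minus_zero by linarith
      then show ?thesis using True by simp
    next
      case False
      show ?thesis
      proof (cases "0 < r")
        case True then show ?thesis using pos by simp
      next
        case False
        then have "f ((- r) *\<^sub>R x) = (- r) * f x" using \<open>r \<noteq> 0\<close> by (intro pos) simp
        then show ?thesis using neg[of "r *\<^sub>R x"] by (simp only: scaleR_minus_left real_scaleR_def)
      qed
    qed
  qed
  then show ?thesis
  proof (rule that)
    show "f x \<le> t" if "(x, t) \<in> G" for x t
      using H(2) that by (intro le) (rule subsetD)
  qed
qed

section \<open>Existence of states\<close>

definition re_part :: "'a::cstar_algebra \<Rightarrow> 'a" where
  "re_part x = (1/2) *\<^sub>R (x + star x)"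

lemma re_part_self_adjoint [simp]: "star (re_part x) = re_part x"
  by (simp add: re_part_def star_scaleR star_add star_star add.commute)

lemma re_part_of_self_adjoint: "star x = x \<Longrightarrow> re_part x = x"
  by (simp add: re_part_def scaleR_2[symmetric])

lemma re_part_add: "re_part (x + y) = re_part x + re_part y"
  by (simp add: re_part_def star_add algebra_simps)

lemma re_part_scaleR: "re_part (r *\<^sub>R x) = r *\<^sub>R re_part x"
  by (simp add: re_part_def star_scaleR algebra_simps)

lemma re_part_minus: "re_part (- x) = - re_part x"
  using re_part_scaleR[of "-1" x] by simp

lemma re_part_diff: "re_part (x - y) = re_part x - re_part y"
  using re_part_add[of x "- y"] by (simp add: re_part_minus)

lemma scaleC_Re_Im: "c *\<^sub>C x = Re c *\<^sub>R x + Im c *\<^sub>R (\<i> *\<^sub>C (x :: 'a::cstar_algebra))"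
proof -
  have "c *\<^sub>C x = (complex_of_real (Re c) + complex_of_real (Im c) * \<i>) *\<^sub>C x"
    by (metis complex_eq mult.commute)
  then show ?thesis
    by (metis scaleC_add_left scaleC_complex_of_real scaleC_scaleC)
qed

text \<open>
  A complex linear functional is determined by its real part \<open>f\<close>, and
  \<open>f x - \<i> f (\<i> x)\<close> recovers it.
\<close>

lemma pu_mapI_of_positive_linear:
  fixes f :: "'a::cstar_algebra \<Rightarrow> real"
  assumes lin: "linear f" and one: "f 1 = 1"
    and pos: "\<And>x. nonneg_el (re_part x) \<Longrightarrow> 0 \<le> f x"
  shows "pu_map (\<lambda>x. Complex (f x) (- f (\<i> *\<^sub>C x)))"
  unfolding pu_map_def clinear_map_def
proof (intro conjI allI impI)
  have add: "f (x + y) = f x + f y" and sc: "f (r *\<^sub>R x) = r * f x"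
    and minus: "f (- x) = - f x" for x y r
    using lin by (auto simp: linear_add linear_scale linear_neg)
  have i: "f (\<i> *\<^sub>C x) = 0" if "star x = x" for x
  proof -
    have "star (\<i> *\<^sub>C x) = - (\<i> *\<^sub>C x)" using that by (simp add: star_scaleC)
    then have "re_part (\<i> *\<^sub>C x) = 0" by (simp add: re_part_def)
    then have "0 \<le> f (\<i> *\<^sub>C x)" "0 \<le> f (- (\<i> *\<^sub>C x))"
      using nonneg_el_scaleR_one[of 0, where 'a='a] by (auto intro!: pos simp: re_part_minus)
    then show ?thesis by (simp add: minus)
  qed
  show "Complex (f 1) (- f (\<i> *\<^sub>C 1)) = 1" by (simp add: one i complex_eq_iff)
  show "Complex (f (x + y)) (- f (\<i> *\<^sub>C (x + y))) =
      Complex (f x) (- f (\<i> *\<^sub>C x)) + Complex (f y) (- f (\<i> *\<^sub>C y))" for x y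
    by (simp add: add scaleC_add_right complex_eq_iff)
  show "Complex (f (c *\<^sub>C x)) (- f (\<i> *\<^sub>C (c *\<^sub>C x))) = c *\<^sub>C Complex (f x) (- f (\<i> *\<^sub>C x))" for c x
  proof -
    have "f (\<i> *\<^sub>C (c *\<^sub>C x)) = Re c * f (\<i> *\<^sub>C x) - Im c * f x"
      unfolding scaleC_Re_Im[of c x]
      by (simp add: scaleC_add_right scaleC_scaleR scaleC_scaleC linear_diff[OF lin] sc)
    moreover have "f (c *\<^sub>C x) = Re c * f x + Im c * f (\<i> *\<^sub>C x)"
      unfolding scaleC_Re_Im[of c x] by (simp add: add sc)
    ultimately show ?thesis by (simp add: scaleC_complex_def complex_eq_iff)
  qed
  fix x :: 'a assume "cstar_positive x"
  then have x: "nonneg_el x" by (simp add: cstar_positive_iff_nonneg_el)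
  then have "star x = x" by (rule nonneg_el_self_adjoint)
  then show "cstar_positive (Complex (f x) (- f (\<i> *\<^sub>C x)))"
    using pos[of x] x by (simp add: positive_complex_iff i re_part_of_self_adjoint)
qed

text \<open>
  As the cone is closed, even \<open>b + e *\<^sub>R 1\<close> lies outside it for some \<open>e > 0\<close>. The constraints
  \<open>f x \<le> t\<close> whenever \<open>re_part x \<le> t\<close>, which express positivity and normalization, are then
  consistent with the additional constraint \<open>f b \<le> - e\<close>.
\<close>

lemma exists_state_negative:
  fixes b :: "'a::cstar_algebra"
  assumes sa: "star b = b" and b: "\<not> nonneg_el b"
  obtains \<phi> :: "'a \<Rightarrow> complex" where "pu_map \<phi>" "Re (\<phi> b) < 0"
proof -
  obtain e where e: "0 < e" "\<not> nonneg_el (b + e *\<^sub>R 1)" using nonneg_el_closed b by blast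
  have one: "nonneg_el (t *\<^sub>R (1::'a)) \<longleftrightarrow> 0 \<le> t" for t
  proof
    assume t: "nonneg_el (t *\<^sub>R (1::'a))"
    show "0 \<le> t"
    proof (rule ccontr)
      assume "\<not> 0 \<le> t"
      then have "nonneg_el (- (t *\<^sub>R (1::'a)))" using nonneg_el_scaleR_one[of "- t"] by simp
      then have "t *\<^sub>R (1::'a) = 0" using t by (rule nonneg_el_antisym[rotated])
      then have "(1::'a) = 0" using \<open>\<not> 0 \<le> t\<close> by simp
      then have "b = 0" by (metis mult_1 mult_zero_left)
      then show False using b nonneg_el_scaleR_one[of 0, where 'a='a] by simp
    qed
  qed (rule nonneg_el_scaleR_one)
  \<comment> \<open>The multiplier \<open>s\<close> counts how often the constraint \<open>f b \<le> - e\<close> is used.\<close>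
  define G where "G = {(x :: 'a, t). \<exists>s\<ge>0. nonneg_el ((t + s * e) *\<^sub>R 1 - re_part (x - s *\<^sub>R b))}"
  have G_diff: "(t + s * e) *\<^sub>R 1 - re_part (x - s *\<^sub>R b) = t *\<^sub>R 1 - re_part x + s *\<^sub>R (b + e *\<^sub>R 1)"
    for x t s
    by (simp add: re_part_diff re_part_scaleR re_part_of_self_adjoint[OF sa] algebra_simps)
  have G_iff: "(x, t) \<in> G \<longleftrightarrow> (\<exists>s\<ge>0. nonneg_el (t *\<^sub>R 1 - re_part x + s *\<^sub>R (b + e *\<^sub>R 1)))" for x t
    unfolding G_def G_diff by simp
  have "dominating_cone G"
    unfolding dominating_cone_def
  proof (intro conjI ballI allI impI)
    fix p q assume "p \<in> G" "q \<in> G"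
    then obtain x t s y u v where p: "p = (x, t)" "0 \<le> s"
        "nonneg_el (t *\<^sub>R 1 - re_part x + s *\<^sub>R (b + e *\<^sub>R 1))" and q: "q = (y, u)" "0 \<le> v"
        "nonneg_el (u *\<^sub>R 1 - re_part y + v *\<^sub>R (b + e *\<^sub>R 1))"
      by (cases p, cases q) (auto simp: G_iff)
    have "(t *\<^sub>R 1 - re_part x + s *\<^sub>R (b + e *\<^sub>R 1)) + (u *\<^sub>R 1 - re_part y + v *\<^sub>R (b + e *\<^sub>R 1)) =
        (t + u) *\<^sub>R 1 - re_part (x + y) + (s + v) *\<^sub>R (b + e *\<^sub>R 1)"
      by (simp add: re_part_add algebra_simps)
    then have "nonneg_el ((t + u) *\<^sub>R 1 - re_part (x + y) + (s + v) *\<^sub>R (b + e *\<^sub>R 1))"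
      using nonneg_el_add[OF p(3) q(3)] by simp
    then have "(x + y, t + u) \<in> G"
      unfolding G_iff using p(2) q(2) by (intro exI[of _ "s + v"]) simp
    then show "p + q \<in> G" by (simp add: p(1) q(1))
  next
    fix r :: real and p assume r: "0 \<le> r" and "p \<in> G"
    then obtain x t s where p: "p = (x, t)" "0 \<le> s"
        "nonneg_el (t *\<^sub>R 1 - re_part x + s *\<^sub>R (b + e *\<^sub>R 1))"
      by (cases p) (auto simp: G_iff)
    have "r *\<^sub>R (t *\<^sub>R 1 - re_part x + s *\<^sub>R (b + e *\<^sub>R 1)) =
        (r * t) *\<^sub>R 1 - re_part (r *\<^sub>R x) + (r * s) *\<^sub>R (b + e *\<^sub>R 1)"
      by (simp add: re_part_scaleR algebra_simps)
    then have "nonneg_el ((r * t) *\<^sub>R 1 - re_part (r *\<^sub>R x) + (r * s) *\<^sub>R (b + e *\<^sub>R 1))"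
      using nonneg_el_scaleR[OF p(3) r] by simp
    then have "(r *\<^sub>R x, r * t) \<in> G"
      unfolding G_iff using p(2) r by (intro exI[of _ "r * s"]) simp
    then show "r *\<^sub>R p \<in> G" by (simp add: p(1))
  next
    fix t assume "(0, t) \<in> G"
    then obtain s where s: "0 \<le> s" "nonneg_el (t *\<^sub>R 1 + s *\<^sub>R (b + e *\<^sub>R 1))"
      by (auto simp: G_iff re_part_of_self_adjoint)
    show "0 \<le> t"
    proof (rule ccontr)
      assume t: "\<not> 0 \<le> t"
      have "s \<noteq> 0"
      proof
        assume "s = 0"
        then have "nonneg_el (t *\<^sub>R (1::'a))" using s(2) by simp
        then show False using t by (simp add: one)
      qed
      have "nonneg_el ((t *\<^sub>R 1 + s *\<^sub>R (b + e *\<^sub>R 1)) + (- t) *\<^sub>R 1)"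
        using t by (intro nonneg_el_add[OF s(2)] nonneg_el_scaleR_one) simp
      then have "nonneg_el (s *\<^sub>R (b + e *\<^sub>R 1))" by simp
      from nonneg_el_scaleR[OF this, of "1 / s"]
      have "nonneg_el ((1 / s) *\<^sub>R s *\<^sub>R (b + e *\<^sub>R 1))" using s(1) by simp
      then show False using e \<open>s \<noteq> 0\<close> by simp
    qed
  qed
  moreover have "(x, norm (re_part x)) \<in> G" for x
    unfolding G_iff by (intro exI[of _ 0]) (simp add: nonneg_el_norm_minus)
  ultimately obtain f where f: "linear f" "\<And>x t. (x, t) \<in> G \<Longrightarrow> f x \<le> t"
    using hahn_banach_cone by metis
  have pos: "0 \<le> f x" if "nonneg_el (re_part x)" for x
  proof -
    have "(- x, 0) \<in> G" unfolding G_iff using that by (intro exI[of _ 0]) (simp add: re_part_minus)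
    then show ?thesis using f(2)[of "- x" 0] linear_neg[OF f(1), of x] by simp
  qed
  have re1: "re_part (1::'a) = 1" by (simp add: re_part_of_self_adjoint)
  have "(1, 1) \<in> G" "(- 1, - 1) \<in> G"
    unfolding G_iff using one[of 0] by (auto intro!: exI[of _ 0] simp: re1 re_part_minus)
  then have "f 1 \<le> 1" "f (- 1) \<le> - 1" by (auto intro: f(2))
  then have "f 1 = 1" using linear_neg[OF f(1), of 1] by simp
  then have "pu_map (\<lambda>x. Complex (f x) (- f (\<i> *\<^sub>C x)))"
    using f(1) pos by (intro pu_mapI_of_positive_linear)
  moreover have "(b, - e) \<in> G"
    unfolding G_iff using one[of 0]
    by (intro exI[of _ 1]) (simp add: re_part_of_self_adjoint sa)
  then have "f b < 0" using f(2)[of b "- e"] e(1) by simp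
  ultimately show ?thesis using that by simp
qed

lemma nonneg_el_iff_states:
  fixes b :: "'a::cstar_algebra"
  assumes "star b = b"
  shows "nonneg_el b \<longleftrightarrow> (\<forall>\<phi>::'a \<Rightarrow> complex. pu_map \<phi> \<longrightarrow> 0 \<le> Re (\<phi> b))"
proof
  assume "nonneg_el b"
  then show "\<forall>\<phi>::'a \<Rightarrow> complex. pu_map \<phi> \<longrightarrow> 0 \<le> Re (\<phi> b)"
    by (auto simp: pu_map_def cstar_positive_iff_nonneg_el[symmetric] positive_complex_iff)
next
  assume "\<forall>\<phi>::'a \<Rightarrow> complex. pu_map \<phi> \<longrightarrow> 0 \<le> Re (\<phi> b)"
  then show "nonneg_el b" using exists_state_negative[OF assms] by (metis not_le)
qed

section \<open>The state space\<close>

lemma pu_map_add: "pu_map f \<Longrightarrow> f (x + y) = f x + f y"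
  and pu_map_scaleC: "pu_map f \<Longrightarrow> f (c *\<^sub>C x) = c *\<^sub>C f x"
  and pu_map_one: "pu_map f \<Longrightarrow> f 1 = 1"
  and pu_map_nonneg_el: "pu_map f \<Longrightarrow> nonneg_el x \<Longrightarrow> nonneg_el (f x)"
  by (simp_all add: pu_map_def clinear_map_def cstar_positive_iff_nonneg_el)

lemma pu_map_scaleR: "pu_map f \<Longrightarrow> f (r *\<^sub>R x) = r *\<^sub>R f x"
  using pu_map_scaleC[of f "of_real r" x] by (simp add: scaleC_complex_of_real)

lemma pu_map_minus: "pu_map f \<Longrightarrow> f (- x) = - f x"
  using pu_map_scaleR[of f "-1" x] by simp

lemma pu_map_diff: "pu_map f \<Longrightarrow> f (x - y) = f x - f y"
  using pu_map_add[of f x "- y"] pu_map_minus[of f y] by simp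

lemma state_nonneg_el:
  fixes \<phi> :: "'a::cstar_algebra \<Rightarrow> complex"
  shows "pu_map \<phi> \<Longrightarrow> nonneg_el x \<Longrightarrow> Im (\<phi> x) = 0 \<and> 0 \<le> Re (\<phi> x)"
  using pu_map_nonneg_el[of \<phi> x] by (simp add: positive_complex_iff flip: cstar_positive_iff_nonneg_el)

lemma state_self_adjoint:
  fixes \<phi> :: "'a::cstar_algebra \<Rightarrow> complex"
  assumes \<phi>: "pu_map \<phi>" and sa: "star x = x"
  shows "Im (\<phi> x) = 0" "\<bar>Re (\<phi> x)\<bar> \<le> norm x"
proof -
  have "nonneg_el (norm x *\<^sub>R 1 - x)" "nonneg_el (norm x *\<^sub>R 1 - (- x))"
    by (rule nonneg_el_norm_minus; simp add: sa star_minus)+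
  from this[THEN state_nonneg_el[OF \<phi>]] show "Im (\<phi> x) = 0" "\<bar>Re (\<phi> x)\<bar> \<le> norm x"
    by (simp_all add: pu_map_diff[OF \<phi>] pu_map_minus[OF \<phi>] pu_map_add[OF \<phi>]
        pu_map_scaleR[OF \<phi>] pu_map_one[OF \<phi>] abs_le_iff)
qed

lemma state_cartesian:
  fixes \<phi> :: "'a::cstar_algebra \<Rightarrow> complex"
  assumes \<phi>: "pu_map \<phi>" and "star u = u" "star v = v"
  shows "\<phi> (u + \<i> *\<^sub>C v) = Complex (Re (\<phi> u)) (Re (\<phi> v))"
  using state_self_adjoint(1)[OF \<phi>] assms
  by (simp add: pu_map_add pu_map_scaleC scaleC_complex_def complex_eq_iff)

lemma state_norm_le:
  fixes \<phi> :: "'a::cstar_algebra \<Rightarrow> complex"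
  assumes \<phi>: "pu_map \<phi>"
  shows "cmod (\<phi> x) \<le> 2 * norm x"
proof -
  obtain u v where uv: "star u = u" "star v = v" "x = u + \<i> *\<^sub>C v" "norm u \<le> norm x" "norm v \<le> norm x"
    using cartesian_decomposition .
  have "cmod (\<phi> x) \<le> \<bar>Re (\<phi> u)\<bar> + \<bar>Re (\<phi> v)\<bar>"
    using cmod_le[of "\<phi> x"] state_cartesian[OF \<phi> uv(1,2)] uv(3) by simp
  then show ?thesis
    using state_self_adjoint(2)[OF \<phi>, of u] state_self_adjoint(2)[OF \<phi>, of v] uv by linarith
qed

lemma state_star:
  fixes \<phi> :: "'a::cstar_algebra \<Rightarrow> complex"
  assumes \<phi>: "pu_map \<phi>"
  shows "\<phi> (star x) = cnj (\<phi> x)"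
proof -
  obtain u v where uv: "star u = u" "star v = v" "x = u + \<i> *\<^sub>C v"
    using cartesian_decomposition by metis
  have "star x = u + \<i> *\<^sub>C (- v)" using uv by (simp add: star_add star_scaleC)
  then show ?thesis
    using state_cartesian[OF \<phi> uv(1,2)] state_cartesian[OF \<phi> uv(1), of "- v"] uv
    by (simp add: star_minus pu_map_minus[OF \<phi>] complex_eq_iff)
qed

lemma norm_le_of_states:
  fixes b :: "'a::cstar_algebra"
  assumes sa: "star b = b" and t: "0 \<le> t"
    and b: "\<And>\<phi>::'a \<Rightarrow> complex. pu_map \<phi> \<Longrightarrow> \<bar>Re (\<phi> b)\<bar> \<le> t"
  shows "norm b \<le> t"
proof (rule norm_le_of_order[OF sa t])
  have "0 \<le> Re (\<phi> (t *\<^sub>R 1 - b))" "0 \<le> Re (\<phi> (t *\<^sub>R 1 + b))" if "pu_map \<phi>" for \<phi> :: "'a \<Rightarrow> complex"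
    using b[OF that] by (simp_all add: pu_map_diff[OF that] pu_map_add[OF that]
        pu_map_scaleR[OF that] pu_map_one[OF that])
  then show "nonneg_el (t *\<^sub>R 1 - b)" "nonneg_el (t *\<^sub>R 1 + b)"
    using sa by (simp_all add: nonneg_el_iff_states star_diff star_add star_scaleR)
qed

text \<open>
  Both Cartesian parts of \<open>x - y\<close> have value \<open>0\<close> in every state, hence norm \<open>0\<close>.
\<close>

lemma states_separate:
  fixes x y :: "'a::cstar_algebra"
  assumes eq: "\<And>\<phi>::'a \<Rightarrow> complex. pu_map \<phi> \<Longrightarrow> \<phi> x = \<phi> y"
  shows "x = y"
proof -
  obtain u v where uv: "star u = u" "star v = v" "x - y = u + \<i> *\<^sub>C v"
    using cartesian_decomposition by metis
  have z: "Re (\<phi> u) = 0 \<and> Re (\<phi> v) = 0" if "pu_map \<phi>" for \<phi> :: "'a \<Rightarrow> complex"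
    using state_cartesian[OF that uv(1,2)] eq[OF that]
    by (simp add: pu_map_diff[OF that] complex_eq_iff flip: uv(3))
  have "norm u \<le> 0" "norm v \<le> 0"
    by (rule norm_le_of_states; simp add: uv(1,2) z)+
  then show ?thesis using uv(3) by simp
qed

lemma self_adjoint_of_states:
  fixes b :: "'a::cstar_algebra"
  assumes "\<And>\<phi>::'a \<Rightarrow> complex. pu_map \<phi> \<Longrightarrow> Im (\<phi> b) = 0"
  shows "star b = b"
  by (rule states_separate) (simp add: state_star assms complex_eq_iff)

text \<open>
  Passage between states as functions, as the positivity results see them, and states as points of
  the dual space.
\<close>

lemma ball_stat_iff:
  "(\<forall>\<phi>\<in>stat. P (wd_apply \<phi>)) \<longleftrightarrow> (\<forall>f :: 'a::cstar_algebra \<Rightarrow> complex. pu_map f \<longrightarrow> P f)"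
proof -
  have "(\<forall>\<phi>\<in>stat. P (wd_apply \<phi>)) \<longleftrightarrow> (\<forall>f\<in>wd_apply ` (stat :: 'a wdual set). P f)" by blast
  then show ?thesis by (simp add: wd_apply_image_stat)
qed

lemma stat_pu_map: "\<phi> \<in> stat \<Longrightarrow> pu_map (wd_apply \<phi>)"
  by (simp add: stat_def)

text \<open>
  The inverse of \<^const>\<open>wd_apply\<close> is continuous from pointwise convergence to the weak-*
  topology, so Tychonoff's theorem applies: the defining conditions of a state are closed, and the
  values at \<open>x\<close> lie in a disc whose radius depends on \<open>x\<close> only.
\<close>

lemma compact_stat: "compact (stat :: 'a::cstar_algebra wdual set)"
proof -
  let ?P = "{f :: 'a \<Rightarrow> complex. pu_map f}"
  let ?B = "PiE UNIV (\<lambda>x :: 'a. cball (0 :: complex) (2 * norm x))"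
  have "compactin (product_topology (\<lambda>_. euclidean) UNIV) ?B"
    by (simp only: compactin_PiE) simp
  then have B: "compact ?B" by (simp add: euclidean_product_topology)
  have "closed {f :: 'a \<Rightarrow> complex. f 1 = 1}"
    "closed {f :: 'a \<Rightarrow> complex. f (x + y) = f x + f y}"
    "closed {f :: 'a \<Rightarrow> complex. f (c *\<^sub>C x) = c *\<^sub>C f x}"
    "closed {f :: 'a \<Rightarrow> complex. cstar_positive x \<longrightarrow> cstar_positive (f x)}" for x y c
    unfolding scaleC_complex_def positive_complex_iff
    by (intro closed_Collect_eq closed_Collect_imp closed_Collect_conj closed_Collect_le
        continuous_intros continuous_on_product_coordinates; simp)+
  then have "closed ?P"
    unfolding pu_map_def clinear_map_def
    by (intro closed_Collect_conj closed_Collect_all) auto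
  moreover have "?P \<subseteq> ?B" by (auto simp: state_norm_le)
  ultimately have "compact ?P" using compact_Int_closed[OF B] by (metis inf.absorb_iff2)
  moreover have "continuous_on ?P Abs_wdual"
    unfolding continuous_on_def tendsto_wdual_iff
  proof (intro ballI allI)
    fix f :: "'a \<Rightarrow> complex" and x assume f: "f \<in> ?P"
    have "((\<lambda>g. g x) \<longlongrightarrow> f x) (at f within ?P)"
      using continuous_on_subset[OF continuous_on_product_coordinates[of x] subset_UNIV] f
      unfolding continuous_on_def by blast
    then have "((\<lambda>g. wd_apply (Abs_wdual g) x) \<longlongrightarrow> f x) (at f within ?P)"
      by (rule Lim_transform_eventually)
        (auto simp: eventually_at_topological wd_apply_Abs_wdual_pu_map intro!: exI[of _ UNIV])
    then show "((\<lambda>g. wd_apply (Abs_wdual g) x) \<longlongrightarrow> wd_apply (Abs_wdual f) x) (at f within ?P)"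
      using f by (simp add: wd_apply_Abs_wdual_pu_map)
  qed
  ultimately have "compact (Abs_wdual ` ?P)" by (rule compact_continuous_image[rotated])
  moreover have "Abs_wdual ` ?P = stat"
    unfolding wd_apply_image_stat[symmetric] by (auto simp: image_image wd_apply_inverse)
  ultimately show ?thesis by simp
qed

lemma convex_stat: "convex (stat :: 'a::cstar_algebra wdual set)"
proof (rule convexI)
  fix \<phi> \<psi> :: "'a wdual" and u v :: real
  assume *: "\<phi> \<in> stat" "\<psi> \<in> stat" "0 \<le> u" "0 \<le> v" "u + v = 1"
  note \<phi> = stat_pu_map[OF *(1)] and \<psi> = stat_pu_map[OF *(2)]
  have "u *\<^sub>R wd_apply \<phi> 1 + v *\<^sub>R wd_apply \<psi> 1 = 1"
    using *(5) by (simp add: pu_map_one[OF \<phi>] pu_map_one[OF \<psi>] flip: scaleR_left_distrib)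
  moreover have "cstar_positive (u *\<^sub>R wd_apply \<phi> x + v *\<^sub>R wd_apply \<psi> x)"
    if "cstar_positive x" for x
    using that *(3,4) state_nonneg_el[OF \<phi>, of x] state_nonneg_el[OF \<psi>, of x]
    by (simp add: cstar_positive_iff_nonneg_el[of x] positive_complex_iff)
  ultimately show "u *\<^sub>R \<phi> + v *\<^sub>R \<psi> \<in> stat"
    unfolding stat_def pu_map_def clinear_map_def scaleC_complex_def
    by (simp add: wd_add wd_scaleC)
qed

lemma cclcvx_obj_stat: "cclcvx_obj (stat :: 'a::cstar_algebra wdual set)"
  by (simp add: cclcvx_obj_def compact_stat convex_stat)

lemma wd_sum: "wd_apply (\<Sum>i\<in>I. F i) x = (\<Sum>i\<in>I. wd_apply (F i) x)"
  by (induction I rule: infinite_finite_induct) simp_all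

lemma continuous_on_wd_apply: "continuous_on S (\<lambda>\<phi>. wd_apply \<phi> x)"
  unfolding continuous_on_def
  using tendsto_wdual_iff[of "\<lambda>\<phi>. \<phi>"] tendsto_ident_at by blast

lemma stat_map_mem:
  assumes f: "pu_map f" and "\<phi> \<in> stat"
  shows "stat_map f \<phi> \<in> stat"
  using assms by (simp add: stat_def wd_apply_stat_map pu_map_comp)

lemma stat_map_cclcvx_hom:
  fixes f :: "'a::cstar_algebra \<Rightarrow> 'b::cstar_algebra"
  assumes f: "pu_map f"
  shows "stat_map f \<in> cclcvx_hom stat stat"
  unfolding cclcvx_hom_def
proof (intro CollectI conjI)
  show "stat_map f \<in> stat \<rightarrow>\<^sub>E stat"
    using stat_map_mem[OF f] by (auto simp: stat_map_def)
  show "continuous_on stat (stat_map f)"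
    unfolding continuous_on_def tendsto_wdual_iff
  proof (intro ballI allI)
    fix \<phi> :: "'b wdual" and x assume \<phi>: "\<phi> \<in> stat"
    have "((\<lambda>\<psi>. wd_apply \<psi> (f x)) \<longlongrightarrow> wd_apply \<phi> (f x)) (at \<phi> within stat)"
      using continuous_on_wd_apply[of stat "f x"] \<phi> unfolding continuous_on_def by blast
    then have "((\<lambda>\<psi>. wd_apply (stat_map f \<psi>) x) \<longlongrightarrow> wd_apply \<phi> (f x)) (at \<phi> within stat)"
      by (rule Lim_transform_eventually)
        (auto simp: eventually_at_topological wd_apply_stat_map[OF f] intro!: exI[of _ UNIV])
    then show "((\<lambda>\<psi>. wd_apply (stat_map f \<psi>) x) \<longlongrightarrow> wd_apply (stat_map f \<phi>) x) (at \<phi> within stat)"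
      by (simp add: wd_apply_stat_map[OF f \<phi>])
  qed
  show "affine_map_on stat (stat_map f)"
    unfolding affine_map_on_def
  proof (intro allI impI)
    fix n :: nat and u :: "nat \<Rightarrow> real" and x :: "nat \<Rightarrow> 'b wdual"
    assume *: "\<forall>i<n. 0 \<le> u i \<and> x i \<in> stat" "(\<Sum>i<n. u i) = 1"
    have "(\<Sum>i<n. u i *\<^sub>R x i) \<in> stat"
      using * by (intro convex_sum convex_stat) auto
    then show "stat_map f (\<Sum>i<n. u i *\<^sub>R x i) = (\<Sum>i<n. u i *\<^sub>R stat_map f (x i))"
      using * by (intro wd_eqI) (simp add: wd_apply_stat_map[OF f] wd_sum)
  qed
qed

lemma stat_map_id: "stat_map (id :: 'a::cstar_algebra \<Rightarrow> 'a) = restrict id stat"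
  unfolding stat_map_def by (rule ext) (simp add: wd_apply_inverse)

lemma stat_map_comp:
  assumes "pu_map f" "pu_map g"
  shows "stat_map (g \<circ> f) = compose stat (stat_map f) (stat_map g)"
proof (rule ext)
  fix \<phi>
  show "stat_map (g \<circ> f) \<phi> = compose stat (stat_map f) (stat_map g) \<phi>"
  proof (cases "\<phi> \<in> stat")
    case True
    have "wd_apply (stat_map (g \<circ> f) \<phi>) = wd_apply (stat_map f (stat_map g \<phi>))"
      using assms True by (simp add: wd_apply_stat_map pu_map_comp stat_map_mem o_assoc)
    then show ?thesis using True by (simp add: compose_def wd_apply_inject)
  qed (simp add: stat_map_def compose_def)
qed

lemma stat_map_faithful:
  fixes f g :: "'a::cstar_algebra \<Rightarrow> 'b::cstar_algebra"
  assumes "pu_map f" "pu_map g" and eq: "stat_map f = stat_map g"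
  shows "f = g"
proof (rule ext)
  fix x
  have "\<forall>\<phi>\<in>stat. wd_apply \<phi> (f x) = wd_apply \<phi> (g x)"
    using wd_apply_stat_map[OF assms(1)] wd_apply_stat_map[OF assms(2)] eq by (metis comp_apply)
  then have "\<forall>\<phi>::'b \<Rightarrow> complex. pu_map \<phi> \<longrightarrow> \<phi> (f x) = \<phi> (g x)"
    unfolding ball_stat_iff[where P = "\<lambda>\<phi>. \<phi> (f x) = \<phi> (g x)"] .
  then show "f x = g x" using states_separate[of "f x" "g x"] by blast
qed

section \<open>Approximation of affine functions\<close>

lemma linear_combination_of_common_kernel:
  fixes l :: "'i \<Rightarrow> 'v::real_vector \<Rightarrow> real"
  assumes "finite F" "subspace E" "linear f" "\<And>i. i \<in> F \<Longrightarrow> linear (l i)"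
    and "\<And>x. x \<in> E \<Longrightarrow> (\<forall>i\<in>F. l i x = 0) \<Longrightarrow> f x = 0"
  shows "\<exists>c. \<forall>x\<in>E. f x = (\<Sum>i\<in>F. c i * l i x)"
  using assms
proof (induction F arbitrary: E rule: finite_induct)
  case empty
  then show ?case by simp
next
  case (insert i F)
  have li: "linear (l i)" and lF: "\<And>j. j \<in> F \<Longrightarrow> linear (l j)" using insert.prems(3) by auto
  have "subspace {x \<in> E. l i x = 0}"
    using insert.prems(1) linear_subspace_kernel[OF li] subspace_inter[of E "{x. l i x = 0}"]
    by (simp add: Int_def)
  then obtain c where c: "\<forall>x\<in>{x \<in> E. l i x = 0}. f x = (\<Sum>j\<in>F. c j * l j x)"
    using insert.IH[of "{x \<in> E. l i x = 0}"] insert.prems(2,4) lF by auto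
  define g where "g x = f x - (\<Sum>j\<in>F. c j * l j x)" for x
  have g: "linear g"
    unfolding g_def using insert.prems(2) lF
    by (intro linear_compose_sub linear_compose_sum) (auto intro!: linearI simp: linear_add linear_scale algebra_simps)
  have "\<exists>k. \<forall>x\<in>E. g x = k * l i x"
  proof (cases "\<forall>x\<in>E. l i x = 0")
    case True
    then show ?thesis using c by (intro exI[of _ 0]) (auto simp: g_def)
  next
    case False
    then obtain z where z: "z \<in> E" "l i z \<noteq> 0" by blast
    have "g x = (g z / l i z) * l i x" if "x \<in> E" for x
    proof -
      define y where "y = x - (l i x / l i z) *\<^sub>R z"
      have "y \<in> E" using that z(1) insert.prems(1) by (simp add: y_def subspace_diff subspace_scale)
      moreover have "l i y = 0" using z(2) by (simp add: y_def linear_diff[OF li] linear_scale[OF li])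
      ultimately have "g y = 0" using c by (simp add: g_def)
      then show ?thesis using z(2) by (simp add: y_def linear_diff[OF g] linear_scale[OF g] field_simps)
    qed
    then show ?thesis by blast
  qed
  then obtain k where k: "\<forall>x\<in>E. g x = k * l i x" by blast
  have "(\<Sum>j\<in>F. (if j = i then k else c j) * l j x) = (\<Sum>j\<in>F. c j * l j x)" for x
    using insert.hyps(2) by (intro sum.cong) auto
  then show ?case
    using k insert.hyps by (intro exI[of _ "\<lambda>j. if j = i then k else c j"]) (auto simp: g_def algebra_simps)
qed

text \<open>
  The linear functional on the span of \<open>S\<close> that is sought has to satisfy
  \<open>g x - e \<le> f x \<le> g x + e\<close> on \<open>S\<close> and to vanish on the common kernel of the \<open>l i\<close>. All these
  constraints are of the form \<open>f (u *\<^sub>R a - v *\<^sub>R b + n) \<le> u * (g a + e) - v * (g b - e)\<close> with \<open>n\<close> in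
  that kernel. They are consistent: if the argument is \<open>0\<close>, then applying \<open>l i1\<close> gives
  \<open>u = v\<close>, and unless \<open>u = 0\<close> all \<open>l i\<close> agree at \<open>a\<close> and \<open>b\<close>, so that
  \<open>g b - g a \<le> 2 * e\<close>. A functional that vanishes on the common kernel is a linear combination of the
  \<open>l i\<close>.
\<close>

lemma affine_approximation_by_linear_combination:
  fixes S :: "'v::real_vector set" and l :: "'i \<Rightarrow> 'v \<Rightarrow> real" and g :: "'v \<Rightarrow> real"
  assumes S: "convex S"
    and affine: "\<And>x y u v. x \<in> S \<Longrightarrow> y \<in> S \<Longrightarrow> 0 \<le> u \<Longrightarrow> 0 \<le> v \<Longrightarrow> u + v = 1 \<Longrightarrow>
      g (u *\<^sub>R x + v *\<^sub>R y) = u * g x + v * g y"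
    and F: "finite F" and lin: "\<And>i. i \<in> F \<Longrightarrow> linear (l i)"
    and one: "i1 \<in> F" "\<And>x. x \<in> S \<Longrightarrow> l i1 x = 1"
    and close: "\<And>x y. x \<in> S \<Longrightarrow> y \<in> S \<Longrightarrow> (\<forall>i\<in>F. l i x = l i y) \<Longrightarrow> g x - g y \<le> 2 * e"
  shows "\<exists>c. \<forall>x\<in>S. \<bar>g x - (\<Sum>i\<in>F. c i * l i x)\<bar> \<le> e"
proof (cases "S = {}")
  case False
  then obtain z0 where z0: "z0 \<in> S" by blast
  \<comment> \<open>Makes the constraints closed under addition: two points can be traded for one.\<close>
  have merge: "\<exists>z\<in>S. u *\<^sub>R x + v *\<^sub>R y = (u + v) *\<^sub>R z \<and> u * g x + v * g y = (u + v) * g z"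
    if "x \<in> S" "y \<in> S" "0 \<le> u" "0 \<le> v" for x y u v
  proof (cases "u + v = 0")
    case True
    then have "u = 0" "v = 0" using that by auto
    then show ?thesis using z0 by auto
  next
    case False
    define z where "z = (u / (u + v)) *\<^sub>R x + (v / (u + v)) *\<^sub>R y"
    have uv: "0 \<le> u / (u + v)" "0 \<le> v / (u + v)" "u / (u + v) + v / (u + v) = 1"
      using that False by (auto simp: add_divide_distrib[symmetric])
    have "z \<in> S" unfolding z_def using S that uv by (intro convexD)
    moreover have "g z = (u / (u + v)) * g x + (v / (u + v)) * g y"
      unfolding z_def using that uv by (intro affine)
    then have "(u + v) * g z = u * g x + v * g y"
      using False by (simp add: add_divide_distrib[symmetric])
    moreover have "(u + v) *\<^sub>R z = u *\<^sub>R x + v *\<^sub>R y"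
      using False by (simp add: z_def scaleR_add_right)
    ultimately show ?thesis by metis
  qed
  \<comment> \<open>The span of \<open>S\<close>; elements outside it carry no constraint, so they are projected to it.\<close>
  define E where "E = {u *\<^sub>R x - v *\<^sub>R y | u v x y. 0 \<le> u \<and> 0 \<le> v \<and> x \<in> S \<and> y \<in> S}"
  have EI: "u *\<^sub>R x - v *\<^sub>R y \<in> E" if "0 \<le> u" "0 \<le> v" "x \<in> S" "y \<in> S" for u v x y
    using that by (auto simp: E_def)
  have E: "subspace E"
  proof (rule subspaceI)
    show "0 \<in> E" using EI[of 0 0 z0 z0] z0 by simp
  next
    fix p q assume "p \<in> E" "q \<in> E"
    then obtain u v x y u' v' x' y' where p: "p = u *\<^sub>R x - v *\<^sub>R y" "0 \<le> u" "0 \<le> v" "x \<in> S" "y \<in> S"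
      and q: "q = u' *\<^sub>R x' - v' *\<^sub>R y'" "0 \<le> u'" "0 \<le> v'" "x' \<in> S" "y' \<in> S"
      unfolding E_def by blast
    obtain a where a: "a \<in> S" "u *\<^sub>R x + u' *\<^sub>R x' = (u + u') *\<^sub>R a"
      using merge[OF p(4) q(4) p(2) q(2)] by blast
    obtain b where b: "b \<in> S" "v *\<^sub>R y + v' *\<^sub>R y' = (v + v') *\<^sub>R b"
      using merge[OF p(5) q(5) p(3) q(3)] by blast
    have "p + q = (u *\<^sub>R x + u' *\<^sub>R x') - (v *\<^sub>R y + v' *\<^sub>R y')" by (simp add: p(1) q(1))
    also have "\<dots> \<in> E" unfolding a(2) b(2) using a(1) b(1) p q by (intro EI) auto
    finally show "p + q \<in> E" .
  next
    fix r p assume "p \<in> E"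
    then obtain u v x y where p: "p = u *\<^sub>R x - v *\<^sub>R y" "0 \<le> u" "0 \<le> v" "x \<in> S" "y \<in> S"
      unfolding E_def by blast
    show "r *\<^sub>R p \<in> E"
    proof (cases "0 \<le> r")
      case True
      then show ?thesis using EI[of "r * u" "r * v" x y] p by (simp add: scaleR_diff_right)
    next
      case False
      then show ?thesis
        using EI[of "- r * v" "- r * u" y x] p by (simp add: scaleR_diff_right mult_nonpos_nonneg)
    qed
  qed
  obtain P where P: "range P \<subseteq> E" "linear P" "\<And>x. x \<in> E \<Longrightarrow> P x = x"
    using linear_exists_left_inverse_on[of id E] E linear_id by (auto simp: inj_on_def)
  define G where "G = {(x, t). \<exists>u v a b. 0 \<le> u \<and> 0 \<le> v \<and> a \<in> S \<and> b \<in> S \<and>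
    (\<forall>i\<in>F. l i (P x) = u * l i a - v * l i b) \<and> t = u * (g a + e) - v * (g b - e)}"
  have GI: "(x, u * (g a + e) - v * (g b - e)) \<in> G"
    if "0 \<le> u" "0 \<le> v" "a \<in> S" "b \<in> S" "\<And>i. i \<in> F \<Longrightarrow> l i (P x) = u * l i a - v * l i b" for x u v a b
    unfolding G_def using that by blast
  have "dominating_cone G"
    unfolding dominating_cone_def
  proof (intro conjI ballI allI impI)
    fix p q assume "p \<in> G" "q \<in> G"
    then obtain x u v a b x' u' v' a' b' where
      p: "p = (x, u * (g a + e) - v * (g b - e))" "0 \<le> u" "0 \<le> v" "a \<in> S" "b \<in> S"
        "\<And>i. i \<in> F \<Longrightarrow> l i (P x) = u * l i a - v * l i b" and
      q: "q = (x', u' * (g a' + e) - v' * (g b' - e))" "0 \<le> u'" "0 \<le> v'" "a' \<in> S" "b' \<in> S"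
        "\<And>i. i \<in> F \<Longrightarrow> l i (P x') = u' * l i a' - v' * l i b'"
      unfolding G_def by blast
    obtain c where c: "c \<in> S" "u *\<^sub>R a + u' *\<^sub>R a' = (u + u') *\<^sub>R c" "u * g a + u' * g a' = (u + u') * g c"
      using merge[OF p(4) q(4) p(2) q(2)] by blast
    obtain d where d: "d \<in> S" "v *\<^sub>R b + v' *\<^sub>R b' = (v + v') *\<^sub>R d" "v * g b + v' * g b' = (v + v') * g d"
      using merge[OF p(5) q(5) p(3) q(3)] by blast
    have "l i (P (x + x')) = (u + u') * l i c - (v + v') * l i d" if i: "i \<in> F" for i
    proof -
      have "l i (u *\<^sub>R a + u' *\<^sub>R a') = l i ((u + u') *\<^sub>R c)"
        "l i (v *\<^sub>R b + v' *\<^sub>R b') = l i ((v + v') *\<^sub>R d)"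
        by (simp_all only: c(2) d(2))
      then have "u * l i a + u' * l i a' = (u + u') * l i c" "v * l i b + v' * l i b' = (v + v') * l i d"
        by (simp_all only: linear_add[OF lin[OF i]] linear_scale[OF lin[OF i]] real_scaleR_def)
      then show ?thesis
        using p(6)[OF i] q(6)[OF i] by (simp add: linear_add[OF P(2)] linear_add[OF lin[OF i]])
    qed
    then have "(x + x', (u + u') * (g c + e) - (v + v') * (g d - e)) \<in> G"
      using p q c(1) d(1) by (intro GI) auto
    moreover have "(u + u') * (g c + e) - (v + v') * (g d - e) =
        (u * (g a + e) - v * (g b - e)) + (u' * (g a' + e) - v' * (g b' - e))"
      using c(3) d(3) by (simp add: algebra_simps)
    ultimately show "p + q \<in> G" by (simp add: p(1) q(1))
  next
    fix r :: real and p assume r: "0 \<le> r" and "p \<in> G"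
    then obtain x u v a b where
      p: "p = (x, u * (g a + e) - v * (g b - e))" "0 \<le> u" "0 \<le> v" "a \<in> S" "b \<in> S"
        "\<And>i. i \<in> F \<Longrightarrow> l i (P x) = u * l i a - v * l i b"
      unfolding G_def by blast
    have "l i (P (r *\<^sub>R x)) = (r * u) * l i a - (r * v) * l i b" if i: "i \<in> F" for i
      using p(6)[OF i] by (simp add: linear_scale[OF P(2)] linear_scale[OF lin[OF i]] right_diff_distrib)
    then have "(r *\<^sub>R x, (r * u) * (g a + e) - (r * v) * (g b - e)) \<in> G"
      using r p(2-5) by (intro GI) auto
    then show "r *\<^sub>R p \<in> G" by (simp add: p(1) algebra_simps)
  next
    fix t assume "(0, t) \<in> G"
    then obtain u v a b where p: "t = u * (g a + e) - v * (g b - e)" "0 \<le> u" "0 \<le> v" "a \<in> S" "b \<in> S"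
        "\<And>i. i \<in> F \<Longrightarrow> l i (P 0) = u * l i a - v * l i b"
      unfolding G_def by blast
    have z: "u * l i a = v * l i b" if "i \<in> F" for i
      using p(6)[OF that] by (simp add: linear_0[OF P(2)] linear_0[OF lin[OF that]])
    have uv: "u = v" using z[OF one(1)] one(2) p(4,5) by simp
    show "0 \<le> t"
    proof (cases "u = 0")
      case True
      then show ?thesis using p(1) uv by simp
    next
      case False
      then have "\<forall>i\<in>F. l i b = l i a" using z uv by auto
      then have "g b - g a \<le> 2 * e" using p(4,5) by (intro close)
      then have "0 \<le> u * (g a - g b + 2 * e)" using p(2) by (intro mult_nonneg_nonneg) auto
      then show ?thesis using p(1) uv by (simp add: algebra_simps)
    qed
  qed
  moreover have "\<exists>t. (x, t) \<in> G" for x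
  proof -
    have "P x \<in> E" using P(1) by blast
    then obtain u v a b where "P x = u *\<^sub>R a - v *\<^sub>R b" "0 \<le> u" "0 \<le> v" "a \<in> S" "b \<in> S"
      unfolding E_def by blast
    then have "(x, u * (g a + e) - v * (g b - e)) \<in> G"
      by (intro GI) (simp_all add: linear_diff[OF lin] linear_scale[OF lin])
    then show ?thesis by blast
  qed
  ultimately obtain f where f: "linear f" "\<And>x t. (x, t) \<in> G \<Longrightarrow> f x \<le> t"
    using hahn_banach_cone by metis
  have vanish: "f x = 0" if "x \<in> E" "\<forall>i\<in>F. l i x = 0" for x
  proof -
    have "(x, 0) \<in> G"
      using GI[of 0 0 z0 z0 x] z0 that P(3) by simp
    moreover have "(- x, 0) \<in> G"
      using GI[of 0 0 z0 z0 "- x"] z0 that P(3)[OF that(1)]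
      by (simp add: linear_neg[OF P(2)] linear_neg[OF lin])
    ultimately have "f x \<le> 0" "f (- x) \<le> 0" by (auto intro: f(2))
    then show ?thesis by (simp add: linear_neg[OF f(1)])
  qed
  have "\<exists>c. \<forall>x\<in>E. f x = (\<Sum>i\<in>F. c i * l i x)"
    by (rule linear_combination_of_common_kernel[OF F E f(1)]) (rule lin vanish; simp)+
  then obtain c where c: "\<forall>x\<in>E. f x = (\<Sum>i\<in>F. c i * l i x)" by blast
  have "\<bar>g x - (\<Sum>i\<in>F. c i * l i x)\<bar> \<le> e" if x: "x \<in> S" for x
  proof -
    have xE: "x \<in> E" using EI[of 1 0 x x] x by simp
    have "(x, g x + e) \<in> G" using GI[of 1 0 x x x] x P(3)[OF xE] by simp
    moreover have "(- x, - (g x - e)) \<in> G"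
      using GI[of 0 1 x x "- x"] x P(3)[OF xE] by (simp add: linear_neg[OF P(2)] linear_neg[OF lin])
    ultimately have "f x \<le> g x + e" "f (- x) \<le> - (g x - e)" by (auto intro: f(2))
    then have "\<bar>g x - f x\<bar> \<le> e" by (simp add: linear_neg[OF f(1)] abs_le_iff)
    then show ?thesis using c xE by simp
  qed
  then show ?thesis by blast
qed simp

text \<open>
  The pairs at which \<open>g\<close> varies by at least \<open>e\<close> form a compact set \<open>C\<close>. The closed conditions
  \<open>l i x = l i y\<close> together force \<open>x = y\<close> and so exclude \<open>C\<close>; finitely many of them already do.
\<close>

lemma finite_family_controls_variation:
  fixes S :: "'v::t2_space set" and l :: "'i \<Rightarrow> 'v \<Rightarrow> real" and g :: "'v \<Rightarrow> real"
  assumes S: "compact S" and g: "continuous_on S g" and e: "0 < e"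
    and l: "\<And>i. i \<in> I \<Longrightarrow> continuous_on S (l i)"
    and sep: "\<And>x y. x \<in> S \<Longrightarrow> y \<in> S \<Longrightarrow> (\<forall>i\<in>I. l i x = l i y) \<Longrightarrow> x = y"
  shows "\<exists>F. finite F \<and> F \<subseteq> I \<and> (\<forall>x\<in>S. \<forall>y\<in>S. (\<forall>i\<in>F. l i x = l i y) \<longrightarrow> g x - g y \<le> e)"
proof -
  have SS: "compact (S \<times> S)" using S by (intro compact_Times)
  then have cl: "closed (S \<times> S)" by (rule compact_imp_closed)
  have diff: "continuous_on (S \<times> S) (\<lambda>p. k (fst p) - k (snd p))" if "continuous_on S k" for k :: "'v \<Rightarrow> real"
    by (intro continuous_intros continuous_on_compose2[OF that]) auto
  define C where "C = {p \<in> S \<times> S. e \<le> g (fst p) - g (snd p)}"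
  define T where "T i = {p \<in> S \<times> S. \<bar>l i (fst p) - l i (snd p)\<bar> \<le> 0}" for i
  have "closed C"
    unfolding C_def by (intro continuous_on_closed_Collect_le diff g cl continuous_intros)
  then have "compact ((S \<times> S) \<inter> C)" using SS by (intro compact_Int_closed)
  moreover have "(S \<times> S) \<inter> C = C" by (auto simp: C_def)
  ultimately have C: "compact C" by simp
  have T: "closed (T i)" if "i \<in> I" for i
    unfolding T_def using that
    by (intro continuous_on_closed_Collect_le diff l cl continuous_intros) auto
  have "C \<inter> (\<Inter>i\<in>I. T i) = {}"
  proof (rule ccontr)
    assume "C \<inter> (\<Inter>i\<in>I. T i) \<noteq> {}"
    then obtain p where p: "p \<in> C" "\<forall>i\<in>I. p \<in> T i" by blast
    then have "fst p \<in> S" "snd p \<in> S" "\<forall>i\<in>I. l i (fst p) = l i (snd p)"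
      by (auto simp: C_def T_def)
    then have "fst p = snd p" by (rule sep)
    then show False using p(1) e by (simp add: C_def)
  qed
  then have "\<not> (\<forall>F. finite F \<longrightarrow> F \<subseteq> I \<longrightarrow> C \<inter> (\<Inter>i\<in>F. T i) \<noteq> {})"
    using compact_imp_fip_image[OF C, of I T] T by auto
  then obtain F where F: "finite F" "F \<subseteq> I" "C \<inter> (\<Inter>i\<in>F. T i) = {}" by auto
  show ?thesis
  proof (intro exI[of _ F] conjI F(1,2) ballI impI)
    fix x y assume xy: "x \<in> S" "y \<in> S" "\<forall>i\<in>F. l i x = l i y"
    show "g x - g y \<le> e"
    proof (rule ccontr)
      assume "\<not> g x - g y \<le> e"
      then have "(x, y) \<in> C" using xy(1,2) by (simp add: C_def)
      moreover have "\<forall>i\<in>F. (x, y) \<in> T i" using xy by (simp add: T_def)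
      ultimately have "(x, y) \<in> C \<inter> (\<Inter>i\<in>F. T i)" by simp
      then show False using F(3) by simp
    qed
  qed
qed
section \<open>Affine functions as elements of the algebra\<close>

lemma stat_separates_points:
  assumes "\<And>\<phi>. \<phi> \<in> stat \<Longrightarrow> wd_apply \<phi> x = wd_apply \<phi> y"
  shows "x = (y :: 'a::cstar_algebra)"
proof (rule states_separate)
  fix f :: "'a \<Rightarrow> complex" assume "pu_map f"
  then show "f x = f y" using ball_stat_iff[of "\<lambda>f. f x = f y"] assms by blast
qed

lemma norm_le_of_stat:
  fixes b :: "'a::cstar_algebra"
  assumes "star b = b" "0 \<le> t" and b: "\<And>\<phi>. \<phi> \<in> stat \<Longrightarrow> \<bar>Re (wd_apply \<phi> b)\<bar> \<le> t"
  shows "norm b \<le> t"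
proof (rule norm_le_of_states[OF assms(1,2)])
  fix f :: "'a \<Rightarrow> complex" assume "pu_map f"
  then show "\<bar>Re (f b)\<bar> \<le> t" using ball_stat_iff[of "\<lambda>f. \<bar>Re (f b)\<bar> \<le> t"] b by blast
qed

lemma stat_eq_of_self_adjoint:
  fixes \<phi> \<psi> :: "'a::cstar_algebra wdual"
  assumes "\<phi> \<in> stat" "\<psi> \<in> stat" and eq: "\<And>a. star a = a \<Longrightarrow> Re (wd_apply \<phi> a) = Re (wd_apply \<psi> a)"
  shows "\<phi> = \<psi>"
proof (rule wd_eqI)
  fix x :: 'a
  obtain u v where uv: "star u = u" "star v = v" "x = u + \<i> *\<^sub>C v"
    using cartesian_decomposition by metis
  show "wd_apply \<phi> x = wd_apply \<psi> x"
    using state_cartesian[OF stat_pu_map[OF assms(1)] uv(1,2)]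
      state_cartesian[OF stat_pu_map[OF assms(2)] uv(1,2)] eq uv by simp
qed

lemma star_sum: "star (sum f I) = (\<Sum>i\<in>I. star (f i))" for f :: "'i \<Rightarrow> 'a::cstar_algebra"
  by (induction I rule: infinite_finite_induct) (simp_all add: star_add)

lemma pu_map_sum: "pu_map f \<Longrightarrow> f (\<Sum>i\<in>I. g i) = (\<Sum>i\<in>I. f (g i))"
  using pu_map_scaleR[of f 0 0]
  by (induction I rule: infinite_finite_induct) (simp_all add: pu_map_add)

text \<open>
  The evaluations at self-adjoint elements separate the states, and evaluation at \<open>1\<close> is the
  functional that is constantly \<open>1\<close> on them. A linear combination of evaluations is an evaluation.
\<close>

lemma affine_function_approximation:
  fixes g :: "'a::cstar_algebra wdual \<Rightarrow> real"
  assumes cont: "continuous_on stat g"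
    and affine: "\<And>x y u v. x \<in> stat \<Longrightarrow> y \<in> stat \<Longrightarrow> 0 \<le> u \<Longrightarrow> 0 \<le> v \<Longrightarrow> u + v = 1 \<Longrightarrow>
      g (u *\<^sub>R x + v *\<^sub>R y) = u * g x + v * g y"
    and e: "0 < e"
  shows "\<exists>b. star b = b \<and> (\<forall>\<phi>\<in>stat. \<bar>g \<phi> - Re (wd_apply \<phi> b)\<bar> \<le> e)"
proof -
  define l where "l a \<phi> = Re (wd_apply \<phi> a)" for a and \<phi> :: "'a wdual"
  have lin: "linear (l a)" for a by (intro linearI) (simp_all add: l_def)
  have lc: "continuous_on stat (l a)" for a
    unfolding l_def by (intro continuous_intros continuous_on_wd_apply)
  have sep: "\<phi> = \<psi>" if "\<phi> \<in> stat" "\<psi> \<in> stat" "\<forall>a\<in>{a. star a = a}. l a \<phi> = l a \<psi>" for \<phi> \<psi>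
    by (rule stat_eq_of_self_adjoint) (use that in \<open>simp_all add: l_def\<close>)
  have e2: "0 < 2 * e" using e by simp
  obtain F where F: "finite F" "F \<subseteq> {a. star a = a}"
    "\<And>x y. x \<in> stat \<Longrightarrow> y \<in> stat \<Longrightarrow> (\<forall>a\<in>F. l a x = l a y) \<Longrightarrow> g x - g y \<le> 2 * e"
    using finite_family_controls_variation[where l = l and I = "{a. star a = a}",
          OF compact_stat cont e2 lc sep] by blast
  have "\<exists>c. \<forall>x\<in>stat. \<bar>g x - (\<Sum>a\<in>insert 1 F. c a * l a x)\<bar> \<le> e"
  proof (rule affine_approximation_by_linear_combination[OF convex_stat affine])
    show "l 1 x = 1" if "x \<in> stat" for x
      using pu_map_one[OF stat_pu_map[OF that]] by (simp add: l_def)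
    show "g x - g y \<le> 2 * e" if "x \<in> stat" "y \<in> stat" "\<forall>a\<in>insert 1 F. l a x = l a y" for x y
      using that by (intro F(3)) auto
  qed (use F(1) lin in simp_all)
  then obtain c where c: "\<And>x. x \<in> stat \<Longrightarrow> \<bar>g x - (\<Sum>a\<in>insert 1 F. c a * l a x)\<bar> \<le> e" by blast
  define b where "b = (\<Sum>a\<in>insert 1 F. c a *\<^sub>R a)"
  have "star b = b"
    unfolding b_def star_sum using F(2) by (intro sum.cong) (auto simp: star_scaleR)
  moreover have "Re (wd_apply \<phi> b) = (\<Sum>a\<in>insert 1 F. c a * l a \<phi>)" if "\<phi> \<in> stat" for \<phi>
    unfolding b_def pu_map_sum[OF stat_pu_map[OF that]] Re_sum
    by (simp add: l_def pu_map_scaleR[OF stat_pu_map[OF that]])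
  ultimately show ?thesis using c by auto
qed

text \<open>
  Approximating elements form a Cauchy sequence since the norm of a self-adjoint element is the
  supremum of its values in states.
\<close>

lemma affine_function_is_evaluation:
  fixes g :: "'a::cstar_algebra wdual \<Rightarrow> real"
  assumes cont: "continuous_on stat g"
    and affine: "\<And>x y u v. x \<in> stat \<Longrightarrow> y \<in> stat \<Longrightarrow> 0 \<le> u \<Longrightarrow> 0 \<le> v \<Longrightarrow> u + v = 1 \<Longrightarrow>
      g (u *\<^sub>R x + v *\<^sub>R y) = u * g x + v * g y"
  shows "\<exists>b. star b = b \<and> (\<forall>\<phi>\<in>stat. Re (wd_apply \<phi> b) = g \<phi>)"
proof -
  have "\<forall>n. \<exists>b. star b = b \<and> (\<forall>\<phi>\<in>stat. \<bar>g \<phi> - Re (wd_apply \<phi> b)\<bar> \<le> inverse (real (Suc n)))"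
    by (intro allI affine_function_approximation[OF cont affine]) simp_all
  then obtain b where b: "\<And>n. star (b n) = b n"
    "\<And>n \<phi>. \<phi> \<in> stat \<Longrightarrow> \<bar>g \<phi> - Re (wd_apply \<phi> (b n))\<bar> \<le> inverse (real (Suc n))"
    by metis
  have lim0: "(\<lambda>n. inverse (real (Suc n))) \<longlonglongrightarrow> 0" by (rule LIMSEQ_inverse_real_of_nat)
  have dist: "norm (b m - b n) \<le> inverse (real (Suc m)) + inverse (real (Suc n))" for m n
  proof (rule norm_le_of_stat)
    fix \<phi> :: "'a wdual" assume \<phi>: "\<phi> \<in> stat"
    have "\<bar>Re (wd_apply \<phi> (b m)) - Re (wd_apply \<phi> (b n))\<bar> \<le> inverse (real (Suc m)) + inverse (real (Suc n))"
      using b(2)[OF \<phi>, of m] b(2)[OF \<phi>, of n] by linarith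
    then show "\<bar>Re (wd_apply \<phi> (b m - b n))\<bar> \<le> inverse (real (Suc m)) + inverse (real (Suc n))"
      by (simp only: pu_map_diff[OF stat_pu_map[OF \<phi>]] minus_complex.sel)
  qed (simp_all add: star_diff b(1))
  have "Cauchy b"
  proof (rule CauchyI)
    fix e :: real assume e: "0 < e"
    then obtain M where M: "\<And>n. n \<ge> M \<Longrightarrow> norm (inverse (real (Suc n)) - 0) < e / 2"
      using LIMSEQ_D[OF lim0, of "e / 2"] by auto
    have "norm (b m - b n) < e" if "m \<ge> M" "n \<ge> M" for m n
      using dist[of m n] M[OF that(1)] M[OF that(2)] unfolding real_norm_def by linarith
    then show "\<exists>M. \<forall>m\<ge>M. \<forall>n\<ge>M. norm (b m - b n) < e" by blast
  qed
  then obtain c where c: "b \<longlonglongrightarrow> c" using Cauchy_convergent convergent_def by blast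
  have "(\<lambda>n. star (b n)) \<longlonglongrightarrow> star c" by (rule bounded_linear.tendsto[OF bounded_linear_star c])
  then have "star c = c" using c by (simp add: b(1) LIMSEQ_unique)
  moreover have "Re (wd_apply \<phi> c) = g \<phi>" if \<phi>: "\<phi> \<in> stat" for \<phi>
  proof -
    note pu = stat_pu_map[OF \<phi>]
    have "bounded_linear (wd_apply \<phi>)"
      by (rule bounded_linear_intro[where K = 2])
        (simp_all add: pu_map_add[OF pu] pu_map_scaleR[OF pu] state_norm_le[OF pu] mult.commute[of _ 2])
    then have "(\<lambda>n. Re (wd_apply \<phi> (b n))) \<longlonglongrightarrow> Re (wd_apply \<phi> c)"
      by (intro tendsto_Re bounded_linear.tendsto[OF _ c])
    moreover have "(\<lambda>n. Re (wd_apply \<phi> (b n))) \<longlonglongrightarrow> g \<phi>"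
    proof (rule Lim_transform2[OF tendsto_const])
      show "(\<lambda>n. g \<phi> - Re (wd_apply \<phi> (b n))) \<longlonglongrightarrow> 0"
        by (rule Lim_null_comparison[OF _ lim0]) (use b(2)[OF \<phi>] in simp)
    qed
    ultimately show ?thesis by (rule LIMSEQ_unique)
  qed
  ultimately show ?thesis by blast
qed

lemma affine_map_on_two:
  assumes "affine_map_on X h" "x \<in> X" "y \<in> X" "0 \<le> u" "0 \<le> v" "u + v = 1"
  shows "h (u *\<^sub>R x + v *\<^sub>R y) = u *\<^sub>R h x + v *\<^sub>R h y"
proof -
  define p where "p i = (if i = (0::nat) then u else v)" for i
  define q where "q i = (if i = (0::nat) then x else y)" for i
  have "\<forall>i<2. 0 \<le> p i \<and> q i \<in> X" using assms by (simp add: p_def q_def)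
  moreover have "(\<Sum>i<2. p i) = 1" using assms(6) by (simp add: p_def numeral_2_eq_2)
  ultimately have "h (\<Sum>i<2. p i *\<^sub>R q i) = (\<Sum>i<2. p i *\<^sub>R h (q i))"
    using assms(1) unfolding affine_map_on_def by blast
  then show ?thesis by (simp add: p_def q_def numeral_2_eq_2)
qed

lemma pullback_of_evaluation:
  fixes h :: "'b::cstar_algebra wdual \<Rightarrow> 'a::cstar_algebra wdual"
  assumes h: "h \<in> cclcvx_hom stat stat"
  shows "\<exists>b. \<forall>\<phi>\<in>stat. wd_apply \<phi> b = wd_apply (h \<phi>) a"
proof -
  have hs: "h \<phi> \<in> stat" if "\<phi> \<in> stat" for \<phi> using h that by (auto simp: cclcvx_hom_def)
  have cont: "continuous_on stat h" and aff: "affine_map_on stat h"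
    using h by (auto simp: cclcvx_hom_def)
  have ev: "\<exists>b. star b = b \<and> (\<forall>\<phi>\<in>stat. Re (wd_apply \<phi> b) = Re (wd_apply (h \<phi>) a))" for a
  proof (rule affine_function_is_evaluation)
    show "continuous_on stat (\<lambda>\<phi>. Re (wd_apply (h \<phi>) a))"
      by (intro continuous_intros continuous_on_compose2[OF continuous_on_wd_apply cont]) auto
    show "Re (wd_apply (h (u *\<^sub>R x + v *\<^sub>R y)) a) = u * Re (wd_apply (h x) a) + v * Re (wd_apply (h y) a)"
      if "x \<in> stat" "y \<in> stat" "0 \<le> u" "0 \<le> v" "u + v = 1" for x y u v
      by (simp add: affine_map_on_two[OF aff that])
  qed
  obtain x y where xy: "star x = x" "star y = y" "a = x + \<i> *\<^sub>C y"
    using cartesian_decomposition by metis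
  obtain b where b: "star b = b" "\<forall>\<phi>\<in>stat. Re (wd_apply \<phi> b) = Re (wd_apply (h \<phi>) x)"
    using ev by blast
  obtain c where c: "star c = c" "\<forall>\<phi>\<in>stat. Re (wd_apply \<phi> c) = Re (wd_apply (h \<phi>) y)"
    using ev by blast
  have "wd_apply \<phi> (b + \<i> *\<^sub>C c) = wd_apply (h \<phi>) a" if "\<phi> \<in> stat" for \<phi>
    using state_cartesian[OF stat_pu_map[OF that] b(1) c(1)] b(2) c(2) that
      state_cartesian[OF stat_pu_map[OF hs[OF that]] xy(1,2)] by (simp add: xy(3))
  then show ?thesis by blast
qed

text \<open>
  The choice of \<open>f a\<close> is forced, because states separate points; therefore identities between
  values of \<open>f\<close> need only be checked in each state \<open>\<phi>\<close>, where they are identities for the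
  state \<open>h \<phi>\<close>.
\<close>

lemma stat_map_full:
  fixes h :: "'b::cstar_algebra wdual \<Rightarrow> 'a::cstar_algebra wdual"
  assumes h: "h \<in> cclcvx_hom stat stat"
  obtains f :: "'a \<Rightarrow> 'b" where "pu_map f" "stat_map f = h"
proof -
  have hs: "pu_map (wd_apply (h \<phi>))" if "\<phi> \<in> stat" for \<phi>
    using h that by (auto simp: cclcvx_hom_def intro!: stat_pu_map)
  obtain f where f: "\<And>a \<phi>. \<phi> \<in> stat \<Longrightarrow> wd_apply \<phi> (f a) = wd_apply (h \<phi>) a"
    using pullback_of_evaluation[OF h] by metis
  have "pu_map f"
    unfolding pu_map_def clinear_map_def
  proof (intro conjI allI impI)
    show "f (x + y) = f x + f y" for x y
      by (rule stat_separates_points) (simp add: f wd_add)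
    show "f (c *\<^sub>C x) = c *\<^sub>C f x" for c x
      by (rule stat_separates_points) (simp add: f wd_scaleC)
    show "f 1 = 1"
      by (rule stat_separates_points) (simp add: f pu_map_one[OF hs] pu_map_one[OF stat_pu_map])
    fix x :: 'a assume "cstar_positive x"
    then have "\<forall>\<phi>\<in>stat. Im (wd_apply \<phi> (f x)) = 0 \<and> 0 \<le> Re (wd_apply \<phi> (f x))"
      using state_nonneg_el[OF hs] by (simp add: f cstar_positive_iff_nonneg_el)
    then have *: "\<forall>\<phi>::'b \<Rightarrow> complex. pu_map \<phi> \<longrightarrow> Im (\<phi> (f x)) = 0 \<and> 0 \<le> Re (\<phi> (f x))"
      using ball_stat_iff[of "\<lambda>\<phi>. Im (\<phi> (f x)) = 0 \<and> 0 \<le> Re (\<phi> (f x))"] by simp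
    then have "star (f x) = f x" by (intro self_adjoint_of_states) simp
    then show "cstar_positive (f x)"
      using * by (simp add: cstar_positive_iff_nonneg_el nonneg_el_iff_states)
  qed
  moreover have "stat_map f = h"
  proof (rule ext)
    fix \<phi>
    show "stat_map f \<phi> = h \<phi>"
    proof (cases "\<phi> \<in> stat")
      case True
      have "wd_apply (stat_map f \<phi>) a = wd_apply (h \<phi>) a" for a
        using wd_apply_stat_map[OF \<open>pu_map f\<close> True] by (simp add: f[OF True])
      then show ?thesis by (rule wd_eqI)
    next
      case False
      have "h \<in> stat \<rightarrow>\<^sub>E stat" using h by (simp add: cclcvx_hom_def)
      then have "h \<phi> = undefined" using False by (rule PiE_arb)
      then show ?thesis using False by (simp add: stat_map_def)
    qed
  qed
  ultimately show ?thesis by (rule that)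
qed

theorem theorem5p21:
  shows
    "cclcvx_obj (stat :: 'a::cstar_algebra wdual set) \<and>
     (\<forall>f :: 'a \<Rightarrow> 'b::cstar_algebra. pu_map f \<longrightarrow>
        stat_map f \<in> cclcvx_hom (stat :: 'b wdual set) (stat :: 'a wdual set)) \<and>
     stat_map (id :: 'a \<Rightarrow> 'a) = restrict id stat \<and>
     (\<forall>(f :: 'a \<Rightarrow> 'b) (g :: 'b \<Rightarrow> 'c::cstar_algebra). pu_map f \<longrightarrow> pu_map g \<longrightarrow>
        stat_map (g \<circ> f) = compose stat (stat_map f) (stat_map g)) \<and>
     (\<forall>f g :: 'a \<Rightarrow> 'b. pu_map f \<longrightarrow> pu_map g \<longrightarrow> stat_map f = stat_map g \<longrightarrow> f = g) \<and>
     (\<forall>h \<in> cclcvx_hom (stat :: 'b wdual set) (stat :: 'a wdual set).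
        \<exists>f :: 'a \<Rightarrow> 'b. pu_map f \<and> stat_map f = h)"
proof (intro conjI allI impI ballI)
  fix h :: "'b wdual \<Rightarrow> 'a wdual" assume "h \<in> cclcvx_hom stat stat"
  then show "\<exists>f. pu_map f \<and> stat_map f = h" using stat_map_full by metis
qed (rule cclcvx_obj_stat stat_map_cclcvx_hom stat_map_id stat_map_comp stat_map_faithful; assumption)+

end
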